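(* Let $W$ be the weakening monad on $[\mathcal H^{\mathrm{op}},\mathbf{Set}]$, i.e. the monad induced by the free-forgetful adjunction $\{w\}\text{-}\mathbf{GAT}\leftrightarrows[\mathcal H^{\mathrm{op}},\mathbf{Set}]$, with $WX$ described by heaps as in the context. For each $X\in[\mathcal H^{\mathrm{op}},\mathbf{Set}]$, the multiplication $\mu^W_X\colon W^2X\to WX$ has components $$W^2X(n)\to WX(n),\ (\psi,(\phi,h))\mapsto(\psi\star\phi,\psi\star h)$$ and $$\mathrm{Tm}_{W^2X}(\psi,(\phi,h))\to\mathrm{Tm}_{WX}(\psi\star\phi,\psi\star h),\ a\mapsto a.$$
   Context: \textbf{Expressions and judgements.} Fix a denumerable set $\mathrm{Var}$ of variables. Given an alphabet $\Xi$, the expressions over $\Xi$ are generated as follows: each $x\in\mathrm{Var}$ is an expression; if $n\geq 0$, $e_1,\dots,e_n$ are expressions and $w\in\Xi$, then $w(e_1,\dots,e_n)$ is an expression (written $w$ when $n=0$). $\mathsf{fv}$ denotes free variables and $e'[e/x]$ substitution of $e$ for $x$ in $e'$. A context is a (possibly empty) list $x_1:T_1,\dots,x_n:T_n$ of distinct variables $x_i$ and expressions $T_i$; $\mathsf{fv}(\Gamma)$ is the set of variables occurring in $\Gamma$. A judgement is a string $\Gamma\vdash T\ \mathsf{type}$ (type judgement), $\Gamma\vdash t:T$ (term judgement), $\Gamma\vdash T=T'\ \mathsf{type}$ (type equality) or $\Gamma\vdash t=t':T$ (term equality), with $\Gamma$ a context and $t,t',T,T'$ expressions; its degree is one more than the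 length of $\Gamma$. The boundary of a judgement is a list of judgements: $\partial(\vdash T\ \mathsf{type})=()$; $\partial(\Gamma,x:T\vdash T'\ \mathsf{type})=(\Gamma\vdash T\ \mathsf{type})$; $\partial(\Gamma\vdash t:T)=(\Gamma\vdash T\ \mathsf{type})$; $\partial(\Gamma\vdash T=T'\ \mathsf{type})=(\Gamma\vdash T\ \mathsf{type},\ \Gamma\vdash T'\ \mathsf{type})$; $\partial(\Gamma\vdash t=t':T)=(\Gamma\vdash t:T,\ \Gamma\vdash t':T)$. \textbf{Deduction rules} (premises $\Longrightarrow$ conclusion; $\mathcal J$ stands for the right-hand side of any of the four judgement forms). \emph{Equality and $\alpha$ rules}: $\Gamma\vdash t:T\Longrightarrow\Gamma\vdash t=t:T$; $\Gamma\vdash t_1=t_2:T\Longrightarrow\Gamma\vdash t_2=t_1:T$; $\Gamma\vdash t_1=t_2:T$ and $\Gamma\vdash t_2=t_3:T\Longrightarrow\Gamma\vdash t_1=t_3:T$; $\Gamma\vdash T\ \mathsf{type}\Longrightarrow\Gamma\vdash T=T\ \mathsf{type}$; $\Gamma\vdash T_1=T_2\ \mathsf{type}\Longrightarrow\Gamma\vdash T_2=T_1\ \mathsf{type}$; $\Gamma\vdash T_1=T_2\ \mathsf{type}$ and $\Gamma\vdash T_2=T_3\ \mathsf{type}\Longrightarrow\Gamma\vdash T_1=T_3\ \mathsf{type}$; $\Gamma\vdash T_1=T_2\ \mathsf{type}$ and $\Gamma\vdash t:T_1\Longrightarrow\Gamma\vdash t:T_2$; $\Gamma\vdash T_1=T_2\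 \mathsf{type}$ and $\Gamma\vdash t_1=t_2:T_1\Longrightarrow\Gamma\vdash t_1=t_2:T_2$; $\Gamma\vdash\mathcal J\Longrightarrow\sigma\cdot\Gamma\vdash\sigma\cdot\mathcal J$ for any permutation $\sigma\in\mathrm{Sym}(\mathrm{Var})$ acting on variables. \emph{Weakening} ($w$): $\Gamma\vdash T\ \mathsf{type}$ and $\Gamma,\Delta\vdash\mathcal J\Longrightarrow\Gamma,y:T,\Delta\vdash\mathcal J$, for $y\notin\mathsf{fv}(\Gamma)\cup\mathsf{fv}(\Delta)$. \textbf{$\{w\}$-GATs.} A $\{w\}$-GAT $\mathbb T$ consists of a collection $\Omega$ of type-constants, a collection $\Sigma$ of term-constants and a collection $\Lambda$ of basic judgements over $\Omega\amalg\Sigma$ such that: for each $A\in\Omega$ there is a unique judgement in $\Lambda$ of the form $x_1:T_1,\dots,x_{n-1}:T_{n-1}\vdash A(x_1,\dots,x_{n-1})\ \mathsf{type}$; for each $f\in\Sigma$ there is a unique judgement in $\Lambda$ of the form $x_1:T_1,\dots,x_{n-1}:T_{n-1}\vdash f(x_1,\dots,x_{n-1}):T$; all other elements of $\Lambda$ are type or term equality judgements; each element of $\Lambda$ lies in $\mathbb T^*$. Here $\mathbb T^*$, the collection of derived judgements, is the smallest collection closed under all the rules listed above and containing $\mathcal J\in\Lambda$ whenever it contains each judgement in $\partial(\mathcal J)$. An interpretation $\phi\colon\mathbb T\to\mathbb U$ is a function $\phi\colon\mathbb T^*\to\mathbb U^*$ preserving boundaries and preserving deduction: viewing each rule with $n$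 premises (for each choice of parameters such as $y$ or $\sigma$) as an $n$-ary partial function $r$ on judgements, $\phi(r(\mathcal J_1,\dots,\mathcal J_n))=r(\phi(\mathcal J_1),\dots,\phi(\mathcal J_n))$ whenever both sides are defined. On derived type judgements, $(x_1:S_1,\dots,x_{n-1}:S_{n-1}\vdash S_n\ \mathsf{type})\equiv(y_1:T_1,\dots,y_{m-1}:T_{m-1}\vdash T_m\ \mathsf{type})$ iff $n=m$ and for $1\le i\le n$ the judgement $x_1:S_1,\dots,x_{i-1}:S_{i-1}\vdash S_i=T_i[x_1/y_1,\dots,x_{i-1}/y_{i-1}]\ \mathsf{type}$ is derived. On derived term judgements, $(x_1:S_1,\dots,x_{n-1}:S_{n-1}\vdash s:S_n)\equiv(y_1:T_1,\dots,y_{m-1}:T_{m-1}\vdash t:T_m)$ iff their boundaries are $\equiv$ and $x_1:S_1,\dots,x_{n-1}:S_{n-1}\vdash s=t[x_1/y_1,\dots,x_{n-1}/y_{n-1}]:S_n$ is derived. $\{w\}\text{-}\mathbf{GAT}$ has $\{w\}$-GATs as objects and, as morphisms, interpretations modulo: $\phi\sim\phi'$ iff $\phi(\mathcal J)\equiv\phi'(\mathcal J)$ for each derived type or term judgement $\mathcal J$. \textbf{Type-and-term structures and the monad.} $[a,b]=\{a,\dots,b\}\subset\mathbb N$ and $[n]=[1,n]$. $\mathcal H$ is the category freely generated by the graph with objects $n$ and $n_t$ ($n\ge1$) and arrows $n\to n+1$ and $n\to n_t$. For $X\in[\mathcal H^{\mathrm{op}},\mathbf{Set}]$ the maps $X(n+1)\to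 X(n)$, $X(n_t)\to X(n)$ are written $\partial$; elements of $X(n)$ are type-elements, elements of $X(n_t)$ term-elements; for $A\in X(n)$, $\mathrm{Tm}_X(A)=\{a\in X(n_t):\partial a=A\}$. The forgetful functor $V\colon\{w\}\text{-}\mathbf{GAT}\to[\mathcal H^{\mathrm{op}},\mathbf{Set}]$ has $V\mathbb T(n)$ (resp. $V\mathbb T(n_t)$) the set of derived type (resp. term) judgements of degree $n$ modulo $\equiv$, boundaries induced by $\partial$, and $V\phi([\mathcal J])=[\phi(\mathcal J)]$. Its left adjoint $G$ sends $X$ to the free $\{w\}$-GAT $GX$ whose type- and term-constants are the type- and term-elements of $X$ and whose basic judgements are $\mathcal J_A=(x_1:A_1,x_2:A_2(x_1),\dots,x_{n-1}:A_{n-1}(x_1,\dots,x_{n-2})\vdash A(x_1,\dots,x_{n-1})\ \mathsf{type})$ for $A\in X(n)$, where $A_i=\partial^{n-i}A$, and, in the same context, $\mathcal J_a=(\dots\vdash a(x_1,\dots,x_{n-1}):A(x_1,\dots,x_{n-1}))$ for $a\in\mathrm{Tm}_X(A)$. The adjunction unit is $\eta_X(A)=[\mathcal J_A]$, $\eta_X(a)=[\mathcal J_a]$; the counit $\epsilon_{\mathbb T}\colon GV\mathbb T\to\mathbb T$ is given on basic judgements by $\mathcal J_{[\mathcal J]}\mapsto\mathcal J$. The monad is $W=VG$ with multiplication $\mu^W=V\epsilon G$. \textbf{Heaps and description of $WX$.} A min-heap of size $n$ is a function $\phi\colon[0,n]\to[0,n]$ with $\phi(0)=0$ and $\phi(i)<i$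 for $i\in[n]$; $\mathrm{Hp}(n)$ is the set of these. For $\phi\in\mathrm{Hp}(n+1)$, $\partial\phi\in\mathrm{Hp}(n)$ is its restriction to $[0,n]$. For $i\in[n]$, $\mathsf{dp}_\phi(i)=|\{\phi(i),\phi^2(i),\dots\}|$. The presheaf $[\phi]$ has $[\phi](m)=\{i\in[n]:\mathsf{dp}_\phi(i)=m\}$, $[\phi](m_t)=\emptyset$, and $\partial(i)=\phi(i)$. For $h\colon[\phi]\to X$, $\partial h$ is its restriction to $[\partial\phi]$. One has $WX(n)=\sum_{\phi\in\mathrm{Hp}(n)}[\mathcal H^{\mathrm{op}},\mathbf{Set}]([\phi],X)$ with $\partial(\phi,h)=(\partial\phi,\partial h)$ and $\mathrm{Tm}_{WX}(\phi,h)=\mathrm{Tm}_X(h(n))$, where $(\phi,h)$ is identified with the class of the judgement $x_1:T_1,\dots,x_{n-1}:T_{n-1}\vdash T_n\ \mathsf{type}$ of $GX$ in which $T_i=h(i)(x_{j_1},\dots,x_{j_{k-1}})$, $k=\mathsf{dp}_\phi(i)$, $j_\ell=\phi^{k-\ell}(i)$; and $a\in\mathrm{Tm}_X(h(n))$ with the class of $x_1:T_1,\dots,x_{n-1}:T_{n-1}\vdash a(x_{j_1},\dots,x_{j_{k-1}}):T_n$, with the indices $j_\ell$ for $i=n$. \textbf{Elements of $W^2X$ and the operation $\star$.} An element of $W^2X(n)$ is a pair $(\psi,(\phi,h))$ with $\psi\in\mathrm{Hp}(n)$ and $(\phi,h)\colon[\psi]\to WX$, i.e. for each $i\in[n]$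 a heap $\phi_i\in\mathrm{Hp}(\#i)$ and a map $h_i\colon[\phi_i]\to X$, where $\#i=\mathsf{dp}_\psi(i)$, such that $(\partial\phi_i,\partial h_i)=(\phi_j,h_j)$ whenever $\psi(i)=j>0$. Moreover $\mathrm{Tm}_{W^2X}(\psi,(\phi,h))=\mathrm{Tm}_{WX}(\phi_n,h_n)=\mathrm{Tm}_X(h_n(\#n))$. The heap $\psi\star\phi\in\mathrm{Hp}(n)$ is $(\psi\star\phi)(i)=\psi^{\#i-\phi_i(\#i)}(i)$ for $i\in[n]$ (and $0\mapsto0$), and $\psi\star h\colon[\psi\star\phi]\to X$ is $(\psi\star h)(i)=h_i(\#i)$. *)

theory Defs
  imports Main "HOL-Library.FuncSet"
begin

section \<open>Expressions and judgements\<close>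

type_synonym var = nat

datatype (fv: 'v, syms: 'w) expr = Var 'v | App 'w "('v, 'w) expr list"

datatype (rhs_fv: 'v, rhs_syms: 'w) rhs =
    is_ty: IsTy "('v, 'w) expr"
  | is_tm: HasTm "('v, 'w) expr" "('v, 'w) expr"  \<comment> \<open>\<open>HasTm t T\<close> is \<open>t : T\<close>\<close>
  | EqTy "('v, 'w) expr" "('v, 'w) expr"
  | EqTm "('v, 'w) expr" "('v, 'w) expr" "('v, 'w) expr"  \<comment> \<open>\<open>EqTm t t' T\<close> is \<open>t = t' : T\<close>\<close>

text \<open>The alphabet is the disjoint union of type-constants (\<open>Inl\<close>) and term-constants (\<open>Inr\<close>).\<close>

type_synonym ('o, 's) exp = "(var, 'o + 's) expr"
type_synonym ('o, 's) ctx = "(var \<times> ('o, 's) exp) list"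
type_synonym ('o, 's) judgement = "('o, 's) ctx \<times> (var, 'o + 's) rhs"

definition ctx_fv :: "('o, 's) ctx \<Rightarrow> var set" where
  "ctx_fv \<Gamma> = (\<Union>(x, T)\<in>set \<Gamma>. insert x (fv T))"

definition judgement_over :: "'o set \<Rightarrow> 's set \<Rightarrow> ('o, 's) judgement \<Rightarrow> bool" where
  "judgement_over \<Omega> \<Sigma> = (\<lambda>(\<Gamma>, R). distinct (map fst \<Gamma>) \<and>
     (\<Union>(x, T)\<in>set \<Gamma>. syms T) \<union> rhs_syms R \<subseteq> \<Omega> <+> \<Sigma>)"

definition degree :: "('o, 's) judgement \<Rightarrow> nat" where
  "degree J = Suc (length (fst J))"

fun boundary :: "('o, 's) judgement \<Rightarrow> ('o, 's) judgement list" where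
  "boundary (\<Gamma>, IsTy T) = (if \<Gamma> = [] then [] else [(butlast \<Gamma>, IsTy (snd (last \<Gamma>)))])"
| "boundary (\<Gamma>, HasTm t T) = [(\<Gamma>, IsTy T)]"
| "boundary (\<Gamma>, EqTy T T') = [(\<Gamma>, IsTy T), (\<Gamma>, IsTy T')]"
| "boundary (\<Gamma>, EqTm t t' T) = [(\<Gamma>, HasTm t T), (\<Gamma>, HasTm t' T)]"

definition permute :: "(var \<Rightarrow> var) \<Rightarrow> ('o, 's) judgement \<Rightarrow> ('o, 's) judgement" where
  "permute \<sigma> = (\<lambda>(\<Gamma>, R). (map (map_prod \<sigma> (map_expr \<sigma> id)) \<Gamma>, map_rhs \<sigma> id R))"

text \<open>\<open>rename ys xs T\<close> is the simultaneous substitution \<open>T[xs/ys]\<close> of variables for variables,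
  the only kind of substitution needed below. Expressions have no binders.\<close>

definition rename :: "var list \<Rightarrow> var list \<Rightarrow> ('o, 's) exp \<Rightarrow> ('o, 's) exp" where
  "rename ys xs = map_expr (\<lambda>v. case map_of (zip ys xs) v of None \<Rightarrow> v | Some x \<Rightarrow> x) id"

section \<open>Deduction rules\<close>

datatype rule =
    ReflTm | SymTm | TransTm | ReflTy | SymTy | TransTy | ConvTm | ConvEqTm
  | Alpha "var \<Rightarrow> var" | Weak var

text \<open>For each rule \<open>r\<close>, the relation \<open>step r\<close> is the graph of a partial function from
  lists of premises to conclusions.\<close>

inductive step :: "rule \<Rightarrow> ('o, 's) judgement list \<Rightarrow> ('o, 's) judgement \<Rightarrow> bool" where
  "step ReflTm [(\<Gamma>, HasTm t T)] (\<Gamma>, EqTm t t T)"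
| "step SymTm [(\<Gamma>, EqTm t1 t2 T)] (\<Gamma>, EqTm t2 t1 T)"
| "step TransTm [(\<Gamma>, EqTm t1 t2 T), (\<Gamma>, EqTm t2 t3 T)] (\<Gamma>, EqTm t1 t3 T)"
| "step ReflTy [(\<Gamma>, IsTy T)] (\<Gamma>, EqTy T T)"
| "step SymTy [(\<Gamma>, EqTy T1 T2)] (\<Gamma>, EqTy T2 T1)"
| "step TransTy [(\<Gamma>, EqTy T1 T2), (\<Gamma>, EqTy T2 T3)] (\<Gamma>, EqTy T1 T3)"
| "step ConvTm [(\<Gamma>, EqTy T1 T2), (\<Gamma>, HasTm t T1)] (\<Gamma>, HasTm t T2)"
| "step ConvEqTm [(\<Gamma>, EqTy T1 T2), (\<Gamma>, EqTm t1 t2 T1)] (\<Gamma>, EqTm t1 t2 T2)"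
| "bij \<sigma> \<Longrightarrow> step (Alpha \<sigma>) [J] (permute \<sigma> J)"
| "y \<notin> ctx_fv \<Gamma> \<union> ctx_fv \<Delta> \<Longrightarrow>
     step (Weak y) [(\<Gamma>, IsTy T), (\<Gamma> @ \<Delta>, R)] (\<Gamma> @ (y, T) # \<Delta>, R)"

section \<open>The category of GATs with weakening\<close>

record ('o, 's) gat =
  TyConst :: "'o set"
  TmConst :: "'s set"
  Basic :: "('o, 's) judgement set"

inductive_set derived :: "('o, 's) gat \<Rightarrow> ('o, 's) judgement set" for T where
  rule: "\<lbrakk>step r Js J; \<forall>K\<in>set Js. K \<in> derived T\<rbrakk> \<Longrightarrow> J \<in> derived T"
| basic: "\<lbrakk>J \<in> Basic T; \<forall>K\<in>set (boundary J). K \<in> derived T\<rbrakk> \<Longrightarrow> J \<in> derived T"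

definition introduces_ty :: "'o \<Rightarrow> ('o, 's) judgement \<Rightarrow> bool" where
  "introduces_ty A J \<longleftrightarrow> (\<exists>\<Gamma>. J = (\<Gamma>, IsTy (App (Inl A) (map (Var \<circ> fst) \<Gamma>))))"

definition introduces_tm :: "'s \<Rightarrow> ('o, 's) judgement \<Rightarrow> bool" where
  "introduces_tm f J \<longleftrightarrow> (\<exists>\<Gamma> T. J = (\<Gamma>, HasTm (App (Inr f) (map (Var \<circ> fst) \<Gamma>)) T))"

definition is_gat :: "('o, 's) gat \<Rightarrow> bool" where
  "is_gat T \<longleftrightarrow>
     (\<forall>J\<in>Basic T. judgement_over (TyConst T) (TmConst T) J) \<and>
     (\<forall>A\<in>TyConst T. \<exists>!J. J \<in> Basic T \<and> introduces_ty A J) \<and>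
     (\<forall>f\<in>TmConst T. \<exists>!J. J \<in> Basic T \<and> introduces_tm f J) \<and>
     (\<forall>J\<in>Basic T. (\<exists>A\<in>TyConst T. introduces_ty A J) \<or> (\<exists>f\<in>TmConst T. introduces_tm f J) \<or>
        (\<exists>\<Gamma> S S'. J = (\<Gamma>, EqTy S S')) \<or> (\<exists>\<Gamma> t t' S. J = (\<Gamma>, EqTm t t' S))) \<and>
     Basic T \<subseteq> derived T"

inductive_set equiv_judgements :: "('o, 's) gat \<Rightarrow> (('o, 's) judgement \<times> ('o, 's) judgement) set"
  for T where
  ty: "\<lbrakk>(\<Gamma>, IsTy S) \<in> derived T; (\<Delta>, IsTy S') \<in> derived T; length \<Gamma> = length \<Delta>;
        \<forall>i\<le>length \<Gamma>.
          (take i \<Gamma>, EqTy ((map snd \<Gamma> @ [S]) ! i)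
            (rename (take i (map fst \<Delta>)) (take i (map fst \<Gamma>)) ((map snd \<Delta> @ [S']) ! i)))
          \<in> derived T\<rbrakk>
       \<Longrightarrow> ((\<Gamma>, IsTy S), (\<Delta>, IsTy S')) \<in> equiv_judgements T"
| tm: "\<lbrakk>(\<Gamma>, HasTm s S) \<in> derived T; (\<Delta>, HasTm t S') \<in> derived T;
        ((\<Gamma>, IsTy S), (\<Delta>, IsTy S')) \<in> equiv_judgements T;
        (\<Gamma>, EqTm s (rename (map fst \<Delta>) (map fst \<Gamma>) t) S) \<in> derived T\<rbrakk>
       \<Longrightarrow> ((\<Gamma>, HasTm s S), (\<Delta>, HasTm t S')) \<in> equiv_judgements T"

text \<open>Boundaries alone do not tell \<open>\<Gamma>, x : S \<turnstile> T type\<close> from \<open>\<Gamma> \<turnstile> t : S\<close>, so preservation of type and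
  of term judgements is required explicitly. Preservation of the two equality forms, and of
  degrees, then follows from that of boundaries.\<close>

definition is_interpretation ::
  "('o, 's) gat \<Rightarrow> ('p, 'q) gat \<Rightarrow> (('o, 's) judgement \<Rightarrow> ('p, 'q) judgement) \<Rightarrow> bool" where
  "is_interpretation T U \<phi> \<longleftrightarrow>
     (\<forall>J\<in>derived T. \<phi> J \<in> derived U \<and> boundary (\<phi> J) = map \<phi> (boundary J) \<and>
        (is_ty (snd (\<phi> J)) \<longleftrightarrow> is_ty (snd J)) \<and> (is_tm (snd (\<phi> J)) \<longleftrightarrow> is_tm (snd J))) \<and>
     (\<forall>r Js J K. set Js \<subseteq> derived T \<longrightarrow> step r Js J \<longrightarrow> step r (map \<phi> Js) K \<longrightarrow> \<phi> J = K)"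

definition interp_equiv ::
  "('o, 's) gat \<Rightarrow> ('p, 'q) gat \<Rightarrow>
   ((('o, 's) judgement \<Rightarrow> ('p, 'q) judgement) \<times> (('o, 's) judgement \<Rightarrow> ('p, 'q) judgement)) set"
  where
  "interp_equiv T U = {(\<phi>, \<phi>'). is_interpretation T U \<phi> \<and> is_interpretation T U \<phi>' \<and>
     (\<forall>J\<in>derived T. is_ty (snd J) \<or> is_tm (snd J) \<longrightarrow> (\<phi> J, \<phi>' J) \<in> equiv_judgements U)}"

definition gat_hom ::
  "('o, 's) gat \<Rightarrow> ('p, 'q) gat \<Rightarrow> (('o, 's) judgement \<Rightarrow> ('p, 'q) judgement) set set" where
  "gat_hom T U = (if is_gat T \<and> is_gat U then Collect (is_interpretation T U) // interp_equiv T U else {})"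

section \<open>Type-and-term structures\<close>

text \<open>A presheaf on \<open>\<H>\<close>, with \<open>Ty X n = X(n)\<close> and \<open>Tm X n = X(n\<^sub>t)\<close> for \<open>n \<ge> 1\<close>;
  \<open>bdTy X n\<close> is \<open>X(n + 1) \<rightarrow> X(n)\<close> and \<open>bdTm X n\<close> is \<open>X(n\<^sub>t) \<rightarrow> X(n)\<close>. As \<open>\<H>\<close> is free on a graph,
  there are no equations. Values at \<open>n = 0\<close> are irrelevant.\<close>

record ('a, 'b) presheaf =
  Ty :: "nat \<Rightarrow> 'a set"
  Tm :: "nat \<Rightarrow> 'b set"
  bdTy :: "nat \<Rightarrow> 'a \<Rightarrow> 'a"
  bdTm :: "nat \<Rightarrow> 'b \<Rightarrow> 'a"

definition is_presheaf :: "('a, 'b) presheaf \<Rightarrow> bool" where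
  "is_presheaf X \<longleftrightarrow> (\<forall>n\<ge>1. bdTy X n ` Ty X (Suc n) \<subseteq> Ty X n \<and> bdTm X n ` Tm X n \<subseteq> Ty X n)"

definition nat_trans ::
  "('a, 'b) presheaf \<Rightarrow> ('c, 'd) presheaf \<Rightarrow> (nat \<Rightarrow> 'a \<Rightarrow> 'c) \<Rightarrow> (nat \<Rightarrow> 'b \<Rightarrow> 'd) \<Rightarrow> bool" where
  "nat_trans X Y f g \<longleftrightarrow> (\<forall>n\<ge>1.
     f n ` Ty X n \<subseteq> Ty Y n \<and> g n ` Tm X n \<subseteq> Tm Y n \<and>
     (\<forall>A\<in>Ty X (Suc n). f n (bdTy X n A) = bdTy Y n (f (Suc n) A)) \<and>
     (\<forall>a\<in>Tm X n. f n (bdTm X n a) = bdTm Y n (g n a)))"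

definition tm_fibre :: "('a, 'b) presheaf \<Rightarrow> nat \<Rightarrow> 'a \<Rightarrow> 'b set" where
  "tm_fibre X n A = {a \<in> Tm X n. bdTm X n a = A}"

section \<open>The free-forgetful adjunction and its monad\<close>

text \<open>The forgetful functor \<open>V\<close>, on objects and on morphisms \<open>T \<rightarrow> U\<close>.\<close>

definition V_obj ::
  "('o, 's) gat \<Rightarrow> (('o, 's) judgement set, ('o, 's) judgement set) presheaf" where
  "V_obj T = \<lparr>
     Ty = (\<lambda>n. {J \<in> derived T. is_ty (snd J) \<and> degree J = n} // equiv_judgements T),
     Tm = (\<lambda>n. {J \<in> derived T. is_tm (snd J) \<and> degree J = n} // equiv_judgements T),
     bdTy = (\<lambda>n c. \<Union>J\<in>c. equiv_judgements T `` set (boundary J)),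
     bdTm = (\<lambda>n c. \<Union>J\<in>c. equiv_judgements T `` set (boundary J))\<rparr>"

definition V_mor ::
  "('p, 'q) gat \<Rightarrow> (('o, 's) judgement \<Rightarrow> ('p, 'q) judgement) set \<Rightarrow>
   ('o, 's) judgement set \<Rightarrow> ('p, 'q) judgement set" where
  "V_mor U m c = (\<Union>\<phi>\<in>m. \<Union>J\<in>c. equiv_judgements U `` {\<phi> J})"

text \<open>\<open>bd_iter X i k\<close> is the map \<open>\<partial>\<^sup>k : X(i + k) \<rightarrow> X(i)\<close>.\<close>

fun bd_iter :: "('a, 'b) presheaf \<Rightarrow> nat \<Rightarrow> nat \<Rightarrow> 'a \<Rightarrow> 'a" where
  "bd_iter X i 0 A = A"
| "bd_iter X i (Suc k) A = bdTy X i (bd_iter X (Suc i) k A)"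

text \<open>The constants of the free GAT are the elements of the presheaf tagged with their degrees,
  and the variable \<open>x\<^sub>i\<close> of its basic judgements is \<open>i\<close>.\<close>

definition free_expr_ty :: "nat \<Rightarrow> 'a \<Rightarrow> (nat \<times> 'a, nat \<times> 'b) exp" where
  "free_expr_ty n A = App (Inl (n, A)) (map Var [1..<n])"

definition free_ctx :: "('a, 'b) presheaf \<Rightarrow> nat \<Rightarrow> 'a \<Rightarrow> (nat \<times> 'a, nat \<times> 'b) ctx" where
  "free_ctx X n A = map (\<lambda>i. (i, free_expr_ty i (bd_iter X i (n - i) A))) [1..<n]"

definition free_ty :: "('a, 'b) presheaf \<Rightarrow> nat \<Rightarrow> 'a \<Rightarrow> (nat \<times> 'a, nat \<times> 'b) judgement" where
  "free_ty X n A = (free_ctx X n A, IsTy (free_expr_ty n A))"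

definition free_tm :: "('a, 'b) presheaf \<Rightarrow> nat \<Rightarrow> 'b \<Rightarrow> (nat \<times> 'a, nat \<times> 'b) judgement" where
  "free_tm X n a = (free_ctx X n (bdTm X n a),
     HasTm (App (Inr (n, a)) (map Var [1..<n])) (free_expr_ty n (bdTm X n a)))"

definition G_obj :: "('a, 'b) presheaf \<Rightarrow> (nat \<times> 'a, nat \<times> 'b) gat" where
  "G_obj X = \<lparr>
     TyConst = (SIGMA n:{1..}. Ty X n),
     TmConst = (SIGMA n:{1..}. Tm X n),
     Basic = {free_ty X n A |n A. n \<ge> 1 \<and> A \<in> Ty X n} \<union> {free_tm X n a |n a. n \<ge> 1 \<and> a \<in> Tm X n}\<rparr>"

definition unit_ty :: "('a, 'b) presheaf \<Rightarrow> nat \<Rightarrow> 'a \<Rightarrow> (nat \<times> 'a, nat \<times> 'b) judgement set" where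
  "unit_ty X n A = equiv_judgements (G_obj X) `` {free_ty X n A}"

definition unit_tm :: "('a, 'b) presheaf \<Rightarrow> nat \<Rightarrow> 'b \<Rightarrow> (nat \<times> 'a, nat \<times> 'b) judgement set" where
  "unit_tm X n a = equiv_judgements (G_obj X) `` {free_tm X n a}"

text \<open>The counit at \<open>T\<close> is the morphism \<open>\<epsilon> : GVT \<rightarrow> T\<close> with \<open>V\<epsilon> \<circ> \<eta> = id\<close>, that is, the one sending the
  basic judgement of a class \<open>[J]\<close> to \<open>J\<close> up to equivalence.\<close>

definition counit ::
  "('o, 's) gat \<Rightarrow>
   ((nat \<times> ('o, 's) judgement set, nat \<times> ('o, 's) judgement set) judgement \<Rightarrow>
    ('o, 's) judgement) set" where
  "counit T = (THE m. m \<in> gat_hom (G_obj (V_obj T)) T \<and>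
     (\<forall>n\<ge>1. (\<forall>c\<in>Ty (V_obj T) n. V_mor T m (unit_ty (V_obj T) n c) = c) \<and>
             (\<forall>c\<in>Tm (V_obj T) n. V_mor T m (unit_tm (V_obj T) n c) = c)))"

abbreviation W_obj ::
  "('a, 'b) presheaf \<Rightarrow>
   ((nat \<times> 'a, nat \<times> 'b) judgement set, (nat \<times> 'a, nat \<times> 'b) judgement set) presheaf" where
  "W_obj X \<equiv> V_obj (G_obj X)"

text \<open>The multiplication \<open>W (W X) \<rightarrow> W X\<close>; its components on type- and term-elements are given
  by the same formula.\<close>

definition W_mult where
  "W_mult X = V_mor (G_obj X) (counit (G_obj X))"

section \<open>Heaps\<close>

text \<open>Functions on \<open>[0,n]\<close> and \<open>[n]\<close> are represented extensionally, so that restriction is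
  the library function \<open>restrict\<close> and equality is equality of functions on these domains.\<close>

definition Hp :: "nat \<Rightarrow> (nat \<Rightarrow> nat) set" where
  "Hp n = {\<phi> \<in> {0..n} \<rightarrow>\<^sub>E {0..n}. \<phi> 0 = 0 \<and> (\<forall>i\<in>{1..n}. \<phi> i < i)}"

definition dp :: "(nat \<Rightarrow> nat) \<Rightarrow> nat \<Rightarrow> nat" where
  "dp \<phi> i = card {(\<phi> ^^ k) i |k. k \<ge> 1}"

definition heap_presheaf :: "nat \<Rightarrow> (nat \<Rightarrow> nat) \<Rightarrow> (nat, unit) presheaf" where
  "heap_presheaf n \<phi> = \<lparr>Ty = (\<lambda>m. {i \<in> {1..n}. dp \<phi> i = m}), Tm = (\<lambda>m. {}),
     bdTy = (\<lambda>m i. \<phi> i), bdTm = (\<lambda>m _. undefined)\<rparr>"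

text \<open>Maps \<open>[\<phi>] \<rightarrow> X\<close>: since every \<open>i \<in> [n]\<close> has a unique degree, the components
  are collected in one function on \<open>[n]\<close>.\<close>

definition heap_maps :: "('a, 'b) presheaf \<Rightarrow> nat \<Rightarrow> (nat \<Rightarrow> nat) \<Rightarrow> (nat \<Rightarrow> 'a) set" where
  "heap_maps X n \<phi> =
     {h \<in> extensional {1..n}. nat_trans (heap_presheaf n \<phi>) X (\<lambda>m. h) (\<lambda>m _. undefined)}"

text \<open>The description of \<open>W X\<close> by heaps. A term-element is a pair of its boundary \<open>(\<phi>, h)\<close>
  and an element of \<open>Tm\<^sub>X(h(n))\<close>.\<close>

definition WH ::
  "('a, 'b) presheaf \<Rightarrow>
   ((nat \<Rightarrow> nat) \<times> (nat \<Rightarrow> 'a), ((nat \<Rightarrow> nat) \<times> (nat \<Rightarrow> 'a)) \<times> 'b) presheaf" where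
  "WH X = \<lparr>
     Ty = (\<lambda>n. SIGMA \<phi>:Hp n. heap_maps X n \<phi>),
     Tm = (\<lambda>n. SIGMA (\<phi>, h):(SIGMA \<phi>:Hp n. heap_maps X n \<phi>). tm_fibre X (dp \<phi> n) (h n)),
     bdTy = (\<lambda>n (\<phi>, h). (restrict \<phi> {0..n}, restrict h {1..n})),
     bdTm = (\<lambda>n. fst)\<rparr>"

section \<open>The identification of \<open>W X\<close> with its description by heaps\<close>

definition heap_args :: "(nat \<Rightarrow> nat) \<Rightarrow> nat \<Rightarrow> (var, 'w) expr list" where
  "heap_args \<phi> i = map (\<lambda>l. Var ((\<phi> ^^ (dp \<phi> i - l)) i)) [1..<dp \<phi> i]"

definition heap_expr ::
  "(nat \<Rightarrow> nat) \<Rightarrow> (nat \<Rightarrow> 'a) \<Rightarrow> nat \<Rightarrow> (nat \<times> 'a, nat \<times> 'b) exp" where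
  "heap_expr \<phi> h i = App (Inl (dp \<phi> i, h i)) (heap_args \<phi> i)"

definition heap_ctx ::
  "nat \<Rightarrow> (nat \<Rightarrow> nat) \<Rightarrow> (nat \<Rightarrow> 'a) \<Rightarrow> (nat \<times> 'a, nat \<times> 'b) ctx" where
  "heap_ctx n \<phi> h = map (\<lambda>i. (i, heap_expr \<phi> h i)) [1..<n]"

definition ident_ty ::
  "('a, 'b) presheaf \<Rightarrow> nat \<Rightarrow> (nat \<Rightarrow> nat) \<times> (nat \<Rightarrow> 'a) \<Rightarrow>
   (nat \<times> 'a, nat \<times> 'b) judgement set" where
  "ident_ty X n = (\<lambda>(\<phi>, h).
     equiv_judgements (G_obj X) `` {(heap_ctx n \<phi> h, IsTy (heap_expr \<phi> h n))})"

definition ident_tm ::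
  "('a, 'b) presheaf \<Rightarrow> nat \<Rightarrow> ((nat \<Rightarrow> nat) \<times> (nat \<Rightarrow> 'a)) \<times> 'b \<Rightarrow>
   (nat \<times> 'a, nat \<times> 'b) judgement set" where
  "ident_tm X n = (\<lambda>((\<phi>, h), a).
     equiv_judgements (G_obj X) `` {(heap_ctx n \<phi> h,
       HasTm (App (Inr (dp \<phi> n, a)) (heap_args \<phi> n)) (heap_expr \<phi> h n))})"

text \<open>The identification of \<open>WH (WH X)\<close> with \<open>W (W X)\<close>: first relabel along
  \<open>WH X \<cong> W X\<close>, then identify \<open>WH (W X)\<close> with \<open>W (W X)\<close>.\<close>

definition relabel ::
  "('a, 'b) presheaf \<Rightarrow> nat \<Rightarrow> (nat \<Rightarrow> nat) \<times> (nat \<Rightarrow> (nat \<Rightarrow> nat) \<times> (nat \<Rightarrow> 'a)) \<Rightarrow>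
   (nat \<Rightarrow> nat) \<times> (nat \<Rightarrow> (nat \<times> 'a, nat \<times> 'b) judgement set)" where
  "relabel X n = (\<lambda>(\<psi>, H). (\<psi>, \<lambda>i\<in>{1..n}. ident_ty X (dp \<psi> i) (H i)))"

definition ident2_ty where
  "ident2_ty X n p = ident_ty (W_obj X) n (relabel X n p)"

definition ident2_tm where
  "ident2_tm X n = (\<lambda>(p, t). ident_tm (W_obj X) n (relabel X n p, ident_tm X (dp (fst p) n) t))"

section \<open>The operation \<open>\<star>\<close>\<close>

definition star_heap ::
  "nat \<Rightarrow> (nat \<Rightarrow> nat) \<Rightarrow> (nat \<Rightarrow> (nat \<Rightarrow> nat) \<times> (nat \<Rightarrow> 'a)) \<Rightarrow> nat \<Rightarrow> nat" where
  "star_heap n \<psi> H = (\<lambda>i\<in>{0..n}.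
     if i = 0 then 0 else (\<psi> ^^ (dp \<psi> i - fst (H i) (dp \<psi> i))) i)"

definition star_map ::
  "nat \<Rightarrow> (nat \<Rightarrow> nat) \<Rightarrow> (nat \<Rightarrow> (nat \<Rightarrow> nat) \<times> (nat \<Rightarrow> 'a)) \<Rightarrow> nat \<Rightarrow> 'a" where
  "star_map n \<psi> H = (\<lambda>i\<in>{1..n}. snd (H i) (dp \<psi> i))"

end

theory Submission
  imports Defs "HOL-Combinatorics.Transposition"
begin

text \<open>A free theory \<open>GX\<close> has no basic equalities, and from a reflexivity the rules derive only
  reflexivities. So every derivable equality has identical sides (\<open>derived_free_EqTy\<close>,
  \<open>derived_free_EqTm\<close>), and two type or term judgements are equivalent exactly when a bijective
  renaming of variables carries one to the other (\<open>equiv_free\<close>). An element of \<open>WX\<close> is therefore a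
  derivable judgement up to renaming, and its boundary can be read off any representative.

  The counit \<open>\<epsilon> : GVGX \<rightarrow> GX\<close> can then be written down. A constant of \<open>GVGX\<close> is a class of judgements
  of \<open>GX\<close>; where it is applied to variables \<open>v\<^sub>1, \<dots>, v\<^sub>k\<close>, put the subject of a representative with
  \<open>v\<^sub>1, \<dots>, v\<^sub>k\<close> for the variables of its context. All representatives give the same expression, the
  operation commutes with every deduction rule (\<open>step_inst_judgement\<close>), and it takes the basic
  judgement of a class to a member of that class (\<open>inst_free_ty\<close>, \<open>inst_free_tm\<close>); hence it is an
  interpretation with the property that characterises the counit. For uniqueness, let \<open>\<phi>\<close> be another
  interpretation with this property. Since an interpretation commutes with all permutations of
  variables, \<open>\<phi>(J)\<close> contains no variable outside \<open>J\<close> (\<open>interpretation_vars\<close>). This and the preservation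
  of boundaries force \<open>\<phi>\<close> to agree with the substitution on basic judgements, and an induction over
  derivations extends the agreement to all judgements (\<open>interpretation_eq_inst\<close>).

  It remains to evaluate the substitution at the judgement of \<open>(\<psi>, (\<phi>, h))\<close>. That judgement is
  derivable because the basic judgement of the last label can be renamed to the chain of ancestors of
  the last node and then weakened by the other nodes, from the smallest upwards (\<open>derived_heap_ty\<close>,
  \<open>derived_heap_tm\<close>). At the node \<open>i\<close> of depth \<open>#i\<close>, the judgement of \<open>(\<phi>\<^sub>i, h\<^sub>i)\<close> is substituted with
  its variable \<open>m\<close> replaced by the ancestor of \<open>i\<close> of depth \<open>m\<close>, which is \<open>\<psi>\<^sup>#\<^sup>i\<^sup>-\<^sup>m(i)\<close>. The parent
  \<open>\<phi>\<^sub>i(#i)\<close> of the last node of \<open>\<phi>\<^sub>i\<close> thus becomes \<open>\<psi>\<close> iterated \<open>#i - \<phi>\<^sub>i(#i)\<close> times at \<open>i\<close>, and this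
  is \<open>(\<psi> \<star> \<phi>)(i)\<close>. The heaps of the ancestors of \<open>i\<close> are restrictions of \<open>\<phi>\<^sub>i\<close>, so the same holds for
  all further ancestors (\<open>funpow_star_heap\<close>), and the result is the judgement of \<open>(\<psi> \<star> \<phi>, \<psi> \<star> h)\<close>.\<close>

section \<open>Renaming of variables\<close>

lemma permute_simp [simp]:
  "permute \<sigma> (\<Gamma>, R) = (map (map_prod \<sigma> (map_expr \<sigma> id)) \<Gamma>, map_rhs \<sigma> id R)"
  by (simp add: permute_def)

lemma permute_permute: "permute \<sigma> (permute \<tau> J) = permute (\<sigma> \<circ> \<tau>) J"
  by (cases J) (auto simp: map_prod_def expr.map_comp rhs.map_comp)

lemma permute_id [simp]: "permute id J = J"
  by (cases J) (simp add: expr.map_id0 rhs.map_id0 map_prod.id)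

lemma permute_inv: "bij \<sigma> \<Longrightarrow> permute (inv \<sigma>) (permute \<sigma> J) = J"
  by (simp add: permute_permute bij_is_inj)

lemma permute_cong:
  assumes "\<And>v. v \<in> ctx_fv \<Gamma> \<union> rhs_fv R \<Longrightarrow> \<sigma> v = \<tau> v"
  shows "permute \<sigma> (\<Gamma>, R) = permute \<tau> (\<Gamma>, R)"
proof -
  have "map_expr \<sigma> id T = map_expr \<tau> id T" if "(x, T) \<in> set \<Gamma>" for x T
    using assms that by (intro expr.map_cong) (auto simp: ctx_fv_def)
  moreover have "map_rhs \<sigma> id R = map_rhs \<tau> id R"
    using assms by (intro rhs.map_cong) auto
  ultimately show ?thesis
    using assms by (fastforce simp: ctx_fv_def)
qed

lemma boundary_permute: "boundary (permute \<sigma> J) = map (permute \<sigma>) (boundary J)"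
proof -
  obtain \<Gamma> R where "J = (\<Gamma>, R)" by (cases J)
  then show ?thesis by (cases R) (simp_all add: map_butlast last_map)
qed

lemma vars_permute: "fst ` set (fst (permute \<sigma> J)) = \<sigma> ` fst ` set (fst J)"
  by (cases J) (simp add: image_image)

lemma is_ty_permute [simp]: "is_ty (snd (permute \<sigma> J)) = is_ty (snd J)"
  by (simp add: permute_def split_beta rhs.map_disc_iff)

lemma is_tm_permute [simp]: "is_tm (snd (permute \<sigma> J)) = is_tm (snd J)"
  by (simp add: permute_def split_beta rhs.map_disc_iff)

lemma degree_permute [simp]: "degree (permute \<sigma> J) = degree J"
  by (simp add: permute_def split_beta degree_def)

lemma rename_map:
  "fv S \<subseteq> set ys \<Longrightarrow> rename ys (map \<sigma> ys) S = map_expr \<sigma> id S"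
  unfolding rename_def by (rule expr.map_cong) (auto simp: map_of_zip_map)

lemma map_expr_inv: "bij \<sigma> \<Longrightarrow> map_expr (inv \<sigma>) id (map_expr \<sigma> id T) = T"
  by (simp add: expr.map_comp bij_is_inj expr.map_id)

lemma rename_inv:
  assumes "bij \<sigma>" "fv S \<subseteq> set ys"
  shows "rename (map \<sigma> ys) ys (map_expr \<sigma> id S) = S"
proof -
  have "rename (map \<sigma> ys) (map (inv \<sigma>) (map \<sigma> ys)) (map_expr \<sigma> id S) = S"
    using assms by (subst rename_map) (auto simp: expr.set_map map_expr_inv)
  then show ?thesis using assms(1) by (simp add: bij_is_inj)
qed

lemma ex_map_eq:
  assumes "distinct ys" "length xs = length ys"
  shows "\<exists>\<rho>. map \<rho> ys = xs"
proof -
  have "map (\<lambda>v. the (map_of (zip ys xs) v)) ys = xs"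
    using assms by (intro nth_equalityI) (auto simp: map_of_zip_nth)
  then show ?thesis by blast
qed

text \<open>By induction on the lists: a bijection that is correct on the tails is corrected at the head by
  a transposition, which moves none of the other prescribed values.\<close>

lemma ex_bij_map_eq:
  fixes xs ys :: "'v list"
  assumes "distinct ys" "distinct xs" "length ys = length xs"
  shows "\<exists>\<sigma>. bij \<sigma> \<and> map \<sigma> ys = xs"
  using assms(3,1,2)
proof (induction ys xs rule: list_induct2)
  case Nil
  show ?case by (rule exI[of _ id], intro conjI bij_id) simp
next
  case (Cons y ys x xs)
  then obtain \<sigma> where \<sigma>: "bij \<sigma>" "map \<sigma> ys = xs" by auto
  let ?\<tau> = "transpose (\<sigma> y) x \<circ> \<sigma>"
  have bij: "bij ?\<tau>" by (rule bij_comp[OF \<sigma>(1)]) simp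
  have "?\<tau> v = \<sigma> v" if "v \<in> set ys" for v
  proof -
    have "\<sigma> v \<noteq> \<sigma> y"
      using that Cons.prems(1) inj_eq[OF bij_is_inj[OF \<sigma>(1)]] by auto
    moreover have "\<sigma> v \<noteq> x" using that Cons.prems(2) \<sigma>(2) by auto
    ultimately show ?thesis by (simp add: transpose_def)
  qed
  then have "map ?\<tau> ys = map \<sigma> ys" by (rule map_cong[OF refl])
  then have "map ?\<tau> (y # ys) = x # xs" using \<sigma>(2) by simp
  with bij show ?case by (intro exI[of _ ?\<tau>] conjI)
qed

section \<open>Derived judgements and their boundaries\<close>

lemma step_unique: "step r Js J \<Longrightarrow> step r Js K \<Longrightarrow> J = K"
proof (induction rule: step.induct)
  case (1 \<Gamma> t T)
  then show ?case by cases auto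
next case 2 then show ?case by cases auto
next case 3 then show ?case by cases auto
next case 4 then show ?case by cases auto
next case 5 then show ?case by cases auto
next case 6 then show ?case by cases auto
next case 7 then show ?case by cases auto
next case 8 then show ?case by cases auto
next case 9 from 9(2) show ?case by cases auto
next case 10 from 10(2) show ?case by cases auto
qed

lemma derived_permute: "J \<in> derived T \<Longrightarrow> bij \<sigma> \<Longrightarrow> permute \<sigma> J \<in> derived T"
  by (rule derived.rule[OF step.intros(9)]) auto

lemma derived_weak:
  assumes "(\<Gamma>, IsTy S) \<in> derived T" "(\<Gamma> @ \<Delta>, R) \<in> derived T" "y \<notin> ctx_fv \<Gamma> \<union> ctx_fv \<Delta>"
  shows "(\<Gamma> @ (y, S) # \<Delta>, R) \<in> derived T"
  using assms by (intro derived.rule[OF step.intros(10)]) auto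

lemma derived_conv:
  assumes "(\<Gamma>, EqTy T1 T2) \<in> derived T" "(\<Gamma>, HasTm t T1) \<in> derived T"
  shows "(\<Gamma>, HasTm t T2) \<in> derived T"
  using assms by (intro derived.rule[OF step.intros(7)]) auto

lemma derived_reflTy: "(\<Gamma>, IsTy S) \<in> derived T \<Longrightarrow> (\<Gamma>, EqTy S S) \<in> derived T"
  by (rule derived.rule[OF step.intros(4)]) simp

lemma derived_reflTm: "(\<Gamma>, HasTm t S) \<in> derived T \<Longrightarrow> (\<Gamma>, EqTm t t S) \<in> derived T"
  by (rule derived.rule[OF step.intros(1)]) simp

text \<open>Case analysis on the last rule. After a weakening, the boundary of a type judgement whose last
  variable is the new one is the first premise; in the other cases the boundary of the second premise is
  weakened in the same way.\<close>

lemma derived_boundary: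
  "J \<in> derived T \<Longrightarrow> K \<in> set (boundary J) \<Longrightarrow> K \<in> derived T"
proof (induction arbitrary: K rule: derived.induct)
  case (rule r Js J)
  from rule.hyps(1) show ?case
  proof cases
    case (9 \<sigma> J')
    then obtain K' where "K' \<in> set (boundary J')" "K = permute \<sigma> K'"
      using rule.prems by (auto simp: boundary_permute)
    moreover have "K' \<in> derived T" using 9 rule.IH calculation(1) by (cases K') auto
    ultimately show ?thesis using 9 by (auto intro: derived_permute)
  next
    case (10 y \<Gamma> \<Delta> S R)
    have prem: "(\<Gamma>, IsTy S) \<in> derived T" "(\<Gamma> @ \<Delta>, R) \<in> derived T"
      and IH: "\<And>K. K \<in> set (boundary (\<Gamma> @ \<Delta>, R)) \<Longrightarrow> K \<in> derived T"
      using 10 rule.IH by auto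
    show ?thesis
    proof (cases R)
      case (IsTy S')
      show ?thesis
      proof (cases "\<Delta> = []")
        case True
        then show ?thesis using IsTy 10 rule.prems prem by auto
      next
        case False
        have "ctx_fv (butlast \<Delta>) \<subseteq> ctx_fv \<Delta>"
          by (auto simp: ctx_fv_def dest: in_set_butlastD)
        then have "(\<Gamma> @ (y, S) # butlast \<Delta>, IsTy (snd (last \<Delta>))) \<in> derived T"
          using 10 prem(1) IH False IsTy
          by (intro derived_weak) (auto simp: butlast_append)
        then show ?thesis using False IsTy 10 rule.prems by (auto simp: butlast_append)
      qed
    qed (use 10 rule.prems prem IH in \<open>auto intro!: derived_weak\<close>)
  qed (use rule in \<open>auto intro: derived_conv\<close>)
qed auto

lemma derived_last:
  assumes "(\<Gamma>, R) \<in> derived T" "\<Gamma> \<noteq> []"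
  shows "(butlast \<Gamma>, IsTy (snd (last \<Gamma>))) \<in> derived T"
proof -
  have ty: "(butlast \<Gamma>, IsTy (snd (last \<Gamma>))) \<in> derived T" if "(\<Gamma>, IsTy S) \<in> derived T" for S
    using derived_boundary[OF that] assms(2) by auto
  have tm: "(butlast \<Gamma>, IsTy (snd (last \<Gamma>))) \<in> derived T" if "(\<Gamma>, HasTm s S) \<in> derived T" for s S
    using derived_boundary[OF that] ty by auto
  show ?thesis
    using assms(1) derived_boundary[OF assms(1)] ty tm by (cases R) (simp_all, blast+)
qed

lemma derived_take:
  "(\<Gamma>, R) \<in> derived T \<Longrightarrow> i < length \<Gamma> \<Longrightarrow> (take i \<Gamma>, IsTy (snd (\<Gamma> ! i))) \<in> derived T"
proof (induction \<Gamma> arbitrary: R rule: rev_induct)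
  case (snoc x \<Gamma>)
  have "(\<Gamma>, IsTy (snd x)) \<in> derived T" using derived_last[OF snoc.prems(1)] by simp
  then show ?case using snoc.IH snoc.prems(2) by (cases "i = length \<Gamma>") (auto simp: nth_append)
qed simp

section \<open>Free theories\<close>

lemma bd_iter_Suc: "bd_iter X i (Suc k) A = bd_iter X i k (bdTy X (i + k) A)"
  by (induction k arbitrary: i) simp_all

lemma free_ctx_Suc_0 [simp]: "free_ctx X (Suc 0) A = []"
  by (simp add: free_ctx_def)

lemma free_ctx_Suc:
  assumes "n \<ge> 1"
  shows "free_ctx X (Suc n) A =
    free_ctx X n (bdTy X n A) @ [(n, free_expr_ty n (bdTy X n A))]"
proof -
  have "bd_iter X i (Suc n - i) A = bd_iter X i (n - i) (bdTy X n A)" if "i < n" for i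
    using that bd_iter_Suc[of X i "n - i" A] by (simp add: Suc_diff_le)
  then show ?thesis
    using assms by (simp add: free_ctx_def)
qed

lemma map_fst_free_ctx [simp]: "map fst (free_ctx X n A) = [1..<n]"
  by (simp add: free_ctx_def comp_def)

lemma fst_free_ctx: "fst ` set (free_ctx X n A) = {1..<n}"
  by (simp flip: set_map)

lemma fv_free_expr_ty: "fv (free_expr_ty n A) = {1..<n}"
  by (auto simp: free_expr_ty_def)

lemma boundary_free_ty:
  "n \<ge> 1 \<Longrightarrow> boundary (free_ty X (Suc n) A) = [free_ty X n (bdTy X n A)]"
  by (simp add: free_ty_def free_ctx_Suc)

lemma boundary_free_ty_Suc_0 [simp]: "boundary (free_ty X (Suc 0) A) = []"
  by (simp add: free_ty_def)

lemma boundary_free_tm: "boundary (free_tm X n a) = [free_ty X n (bdTm X n a)]"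
  by (simp add: free_ty_def free_tm_def)

lemma presheaf_bdTy: "is_presheaf X \<Longrightarrow> n \<ge> 1 \<Longrightarrow> A \<in> Ty X (Suc n) \<Longrightarrow> bdTy X n A \<in> Ty X n"
  and presheaf_bdTm: "is_presheaf X \<Longrightarrow> n \<ge> 1 \<Longrightarrow> a \<in> Tm X n \<Longrightarrow> bdTm X n a \<in> Ty X n"
  unfolding is_presheaf_def by blast+

lemma Basic_G_obj:
  "Basic (G_obj X) = {free_ty X n A |n A. n \<ge> 1 \<and> A \<in> Ty X n} \<union> {free_tm X n a |n a. n \<ge> 1 \<and> a \<in> Tm X n}"
  by (simp add: G_obj_def)

lemma basic_free_ty: "n \<ge> 1 \<Longrightarrow> A \<in> Ty X n \<Longrightarrow> free_ty X n A \<in> Basic (G_obj X)"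
  and basic_free_tm: "n \<ge> 1 \<Longrightarrow> a \<in> Tm X n \<Longrightarrow> free_tm X n a \<in> Basic (G_obj X)"
  unfolding Basic_G_obj by blast+

lemma derived_free_ty:
  assumes X: "is_presheaf X"
  shows "n \<ge> 1 \<Longrightarrow> A \<in> Ty X n \<Longrightarrow> free_ty X n A \<in> derived (G_obj X)"
proof (induction n arbitrary: A rule: nat_induct_at_least)
  case base
  then show ?case using basic_free_ty[of 1 A X] by (intro derived.basic) simp_all
next
  case (Suc n)
  then have "free_ty X (Suc n) A \<in> Basic (G_obj X)" by (intro basic_free_ty) simp_all
  then show ?case
    using Suc.IH[OF presheaf_bdTy[OF X Suc.hyps Suc.prems]] Suc.hyps
    by (intro derived.basic) (simp_all add: boundary_free_ty)
qed

lemma derived_free_tm: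
  assumes X: "is_presheaf X" and a: "n \<ge> 1" "a \<in> Tm X n"
  shows "free_tm X n a \<in> derived (G_obj X)"
  using basic_free_tm[OF a] derived_free_ty[OF X a(1) presheaf_bdTm[OF X a]]
  by (intro derived.basic) (simp_all add: boundary_free_tm)

lemma bd_iter_mem:
  assumes "is_presheaf X"
  shows "i \<ge> 1 \<Longrightarrow> A \<in> Ty X (i + k) \<Longrightarrow> bd_iter X i k A \<in> Ty X i"
proof (induction k arbitrary: i)
  case (Suc k)
  then show ?case using presheaf_bdTy[OF assms, of i] by simp
qed simp

text \<open>The head constant of a basic judgement determines the element that it comes from, whence the
  uniqueness clauses.\<close>

lemma is_gat_G_obj:
  assumes "is_presheaf X"
  shows "is_gat (G_obj X)"
proof -
  have syms_ctx: "(\<Union>(x, T)\<in>set (free_ctx X n A). syms T) \<subseteq> (SIGMA n:{1..}. Ty X n) <+> B"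
    if "A \<in> Ty X n" for n A and B :: "(nat \<times> 'b) set"
    using that bd_iter_mem[OF assms, of _ A]
    by (auto simp: free_ctx_def free_expr_ty_def)
  have over: "judgement_over (TyConst (G_obj X)) (TmConst (G_obj X)) J" if J: "J \<in> Basic (G_obj X)" for J
    using J
  proof (simp add: G_obj_def, elim disjE exE conjE)
    fix n A assume "J = free_ty X n A" "Suc 0 \<le> n" "A \<in> Ty X n"
    then show "judgement_over (SIGMA n:{Suc 0..}. Ty X n) (SIGMA n:{Suc 0..}. Tm X n) J"
      using syms_ctx[of A n]
      by (auto simp: judgement_over_def free_ty_def free_expr_ty_def simp del: UN_subset_iff)
  next
    fix n a assume a: "J = free_tm X n a" "Suc 0 \<le> n" "a \<in> Tm X n"
    then show "judgement_over (SIGMA n:{Suc 0..}. Ty X n) (SIGMA n:{Suc 0..}. Tm X n) J"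
      using syms_ctx[of "bdTm X n a" n] presheaf_bdTm[OF assms, of n a]
      by (auto simp: judgement_over_def free_tm_def free_expr_ty_def simp del: UN_subset_iff)
  qed
  have intro_ty: "introduces_ty (n, A) J \<longleftrightarrow> J = free_ty X n A" if "J \<in> Basic (G_obj X)" for n A J
    using that
    by (auto simp: G_obj_def introduces_ty_def free_ty_def free_tm_def free_expr_ty_def
        simp flip: map_map)
  have intro_tm: "introduces_tm (n, a) J \<longleftrightarrow> J = free_tm X n a" if "J \<in> Basic (G_obj X)" for n a J
    using that
    by (auto simp: G_obj_def introduces_tm_def free_ty_def free_tm_def free_expr_ty_def
        simp flip: map_map)
  have basic: "Basic (G_obj X) \<subseteq> derived (G_obj X)"
    using derived_free_ty[OF assms] derived_free_tm[OF assms]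
    unfolding Basic_G_obj by blast
  have mem_ty: "free_ty X n A \<in> Basic (G_obj X)" if "(n, A) \<in> TyConst (G_obj X)" for n A
    using that by (auto simp: G_obj_def)
  have mem_tm: "free_tm X n a \<in> Basic (G_obj X)" if "(n, a) \<in> TmConst (G_obj X)" for n a
    using that by (auto simp: G_obj_def)
  have mem: "(\<exists>A\<in>TyConst (G_obj X). introduces_ty A J) \<or> (\<exists>f\<in>TmConst (G_obj X). introduces_tm f J)"
    if "J \<in> Basic (G_obj X)" for J
    using that intro_ty[OF that] intro_tm[OF that] by (auto simp: G_obj_def)
  show ?thesis
    unfolding is_gat_def
  proof (intro conjI ballI)
    fix c assume "c \<in> TyConst (G_obj X)"
    then show "\<exists>!J. J \<in> Basic (G_obj X) \<and> introduces_ty c J"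
      using mem_ty intro_ty by (cases c) metis
  next
    fix c assume "c \<in> TmConst (G_obj X)"
    then show "\<exists>!J. J \<in> Basic (G_obj X) \<and> introduces_tm c J"
      using mem_tm intro_tm by (cases c) metis
  qed (use over basic mem in blast)+
qed


text \<open>Expressions of a free theory are flat: a type- or term-element of degree \<open>k\<close> applied to
  \<open>k - 1\<close> variables. In \<open>rhs_shape\<close> the sides of an equality are required to coincide, which makes the
  condition an invariant of derivations.\<close>

definition ty_shape :: "('a, 'b) presheaf \<Rightarrow> (nat \<times> 'a, nat \<times> 'b) exp \<Rightarrow> bool" where
  "ty_shape X T \<longleftrightarrow> (\<exists>k A vs. T = App (Inl (k, A)) (map Var vs) \<and> A \<in> Ty X k \<and> k = Suc (length vs))"

definition tm_shape :: "('a, 'b) presheaf \<Rightarrow> (nat \<times> 'a, nat \<times> 'b) exp \<Rightarrow> bool" where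
  "tm_shape X t \<longleftrightarrow> (\<exists>k a vs. t = App (Inr (k, a)) (map Var vs) \<and> a \<in> Tm X k \<and> k = Suc (length vs))"

fun rhs_shape :: "('a, 'b) presheaf \<Rightarrow> (var, (nat \<times> 'a) + (nat \<times> 'b)) rhs \<Rightarrow> bool" where
  "rhs_shape X (IsTy T) \<longleftrightarrow> ty_shape X T"
| "rhs_shape X (HasTm t T) \<longleftrightarrow> tm_shape X t \<and> ty_shape X T"
| "rhs_shape X (EqTy T T') \<longleftrightarrow> T = T' \<and> ty_shape X T"
| "rhs_shape X (EqTm t t' T) \<longleftrightarrow> t = t' \<and> tm_shape X t \<and> ty_shape X T"

lemma ty_shape_map: "ty_shape X T \<Longrightarrow> ty_shape X (map_expr \<sigma> id T)"
proof -
  assume "ty_shape X T"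
  then obtain k A vs where T: "T = App (Inl (k, A)) (map Var vs)" "A \<in> Ty X k" "k = Suc (length vs)"
    unfolding ty_shape_def by blast
  then have "map_expr \<sigma> id T = App (Inl (k, A)) (map Var (map \<sigma> vs))" by simp
  then show ?thesis using T(2,3) unfolding ty_shape_def by (metis length_map)
qed

lemma tm_shape_map: "tm_shape X T \<Longrightarrow> tm_shape X (map_expr \<sigma> id T)"
proof -
  assume "tm_shape X T"
  then obtain k a vs where T: "T = App (Inr (k, a)) (map Var vs)" "a \<in> Tm X k" "k = Suc (length vs)"
    unfolding tm_shape_def by blast
  then have "map_expr \<sigma> id T = App (Inr (k, a)) (map Var (map \<sigma> vs))" by simp
  then show ?thesis using T(2,3) unfolding tm_shape_def by (metis length_map)
qed

lemma rhs_shape_map: "rhs_shape X R \<Longrightarrow> rhs_shape X (map_rhs \<sigma> id R)"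
  by (cases R) (auto intro: ty_shape_map tm_shape_map)

lemma ty_shape_free_expr: "n \<ge> 1 \<Longrightarrow> A \<in> Ty X n \<Longrightarrow> ty_shape X (free_expr_ty n A)"
  unfolding ty_shape_def free_expr_ty_def
  by (intro exI[of _ n] exI[of _ A] exI[of _ "[1..<n]"]) simp

text \<open>All three parts are preserved by each rule. The second says only that the right-hand side is in
  scope; with \<open>derived_take\<close> it yields that every type of the context is in scope of the variables
  before it (\<open>derived_free_ctx_shape\<close>).\<close>

lemma derived_free_shape:
  assumes X: "is_presheaf X" and "(\<Gamma>, R) \<in> derived (G_obj X)"
  shows "distinct (map fst \<Gamma>) \<and> rhs_fv R \<subseteq> fst ` set \<Gamma> \<and> rhs_shape X R"
proof -
  let ?P = "\<lambda>J. distinct (map fst (fst J)) \<and> rhs_fv (snd J) \<subseteq> fst ` set (fst J) \<and> rhs_shape X (snd J)"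
  have "?P J" if "J \<in> derived (G_obj X)" for J
    using that
  proof (induction rule: derived.induct)
    case (rule r Js J)
    from rule.hyps(1) show ?case
    proof cases
      case (9 \<sigma> K)
      obtain \<Gamma> R where K: "K = (\<Gamma>, R)" by (cases K)
      have IH: "?P K" using 9 rule.IH by auto
      have "distinct (map \<sigma> (map fst \<Gamma>))"
        using IH 9(4) K by (simp add: distinct_map inj_on_subset[OF bij_is_inj] del: map_map)
      then show ?thesis
        using IH by (force simp: 9 K rhs.set_map comp_def image_iff rhs_shape_map)
    next
      case (10 y \<Gamma> \<Delta> S R)
      then have "?P (\<Gamma> @ \<Delta>, R)" using rule.IH by auto
      then show ?thesis using 10 by (auto simp: ctx_fv_def)
    qed (use rule.IH in \<open>auto\<close>)
  next
    case (basic J)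
    have ty: "?P (free_ty X n A)" if "n \<ge> 1" "A \<in> Ty X n" for n A
      using ty_shape_free_expr[OF that] by (simp add: free_ty_def fv_free_expr_ty fst_free_ctx)
    have tm: "?P (free_tm X n a)" if "n \<ge> 1" "a \<in> Tm X n" for n a
    proof -
      have "tm_shape X (App (Inr (n, a)) (map Var [1..<n]))"
        using that unfolding tm_shape_def by (intro exI[of _ n] exI[of _ a] exI[of _ "[1..<n]"]) simp
      then show ?thesis
        using ty_shape_free_expr[OF that(1) presheaf_bdTm[OF X that]]
        by (auto simp: free_tm_def fv_free_expr_ty fst_free_ctx)
    qed
    from basic.hyps ty tm show ?case unfolding Basic_G_obj by blast
  qed
  from this[OF assms(2)] show ?thesis by simp
qed

text \<open>No basic judgement of a free theory is an equality, and the deduction rules create none between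
  different expressions.\<close>

lemma derived_free_EqTy:
  assumes "is_presheaf X"
  shows "(\<Gamma>, EqTy S S') \<in> derived (G_obj X) \<longleftrightarrow> S = S' \<and> (\<Gamma>, IsTy S) \<in> derived (G_obj X)"
proof
  assume A: "(\<Gamma>, EqTy S S') \<in> derived (G_obj X)"
  show "S = S' \<and> (\<Gamma>, IsTy S) \<in> derived (G_obj X)"
    using derived_free_shape[OF assms A] derived_boundary[OF A, of "(\<Gamma>, IsTy S)"] by auto
qed (auto simp: derived_reflTy)

lemma derived_free_EqTm:
  assumes "is_presheaf X"
  shows "(\<Gamma>, EqTm s s' S) \<in> derived (G_obj X) \<longleftrightarrow> s = s' \<and> (\<Gamma>, HasTm s S) \<in> derived (G_obj X)"
proof
  assume A: "(\<Gamma>, EqTm s s' S) \<in> derived (G_obj X)"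
  show "s = s' \<and> (\<Gamma>, HasTm s S) \<in> derived (G_obj X)"
    using derived_free_shape[OF assms A] derived_boundary[OF A, of "(\<Gamma>, HasTm s S)"] by auto
qed (auto simp: derived_reflTm)

lemma derived_free_ctx_shape:
  assumes X: "is_presheaf X" and "(\<Gamma>, R) \<in> derived (G_obj X)" and "i < length \<Gamma>"
  shows "fv (snd (\<Gamma> ! i)) \<subseteq> set (take i (map fst \<Gamma>)) \<and> ty_shape X (snd (\<Gamma> ! i))"
  using derived_free_shape[OF X derived_take[OF assms(2,3)]] by (simp add: take_map)

lemma ctx_fv_derived_free:
  assumes X: "is_presheaf X" and der: "(\<Gamma>, R) \<in> derived (G_obj X)"
  shows "ctx_fv \<Gamma> = fst ` set \<Gamma>"
proof -
  have "insert (fst p) (fv (snd p)) \<subseteq> fst ` set \<Gamma>" if p: "p \<in> set \<Gamma>" for p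
  proof -
    obtain i where i: "i < length \<Gamma>" "\<Gamma> ! i = p" using p by (auto simp: in_set_conv_nth)
    have "fv (snd p) \<subseteq> set (take i (map fst \<Gamma>))"
      using derived_free_ctx_shape[OF X der i(1)] i(2) by simp
    also have "\<dots> \<subseteq> fst ` set \<Gamma>"
      using set_take_subset[of i "map fst \<Gamma>"] by simp
    finally show ?thesis using p by simp
  qed
  then have "ctx_fv \<Gamma> \<subseteq> fst ` set \<Gamma>"
    unfolding ctx_fv_def split_beta by (rule UN_least)
  moreover have "fst ` set \<Gamma> \<subseteq> ctx_fv \<Gamma>" by (auto simp: ctx_fv_def)
  ultimately show ?thesis by (rule equalityI)
qed

section \<open>Equivalence in a free theory is renaming\<close>

text \<open>The derived equalities in the definition of equivalence are identities, so each type of \<open>\<Gamma>\<close> is the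
  image of the corresponding one of \<open>\<Delta>\<close> under the inverse of the bijection matching the variables.\<close>

lemma equiv_free_ty_permute:
  assumes X: "is_presheaf X"
    and der: "(\<Gamma>, IsTy S) \<in> derived (G_obj X)" "(\<Delta>, IsTy S') \<in> derived (G_obj X)"
    and eq: "((\<Gamma>, IsTy S), (\<Delta>, IsTy S')) \<in> equiv_judgements (G_obj X)"
    and \<sigma>: "map \<sigma> (map fst \<Gamma>) = map fst \<Delta>" "bij \<sigma>"
  shows "permute \<sigma> (\<Gamma>, IsTy S) = (\<Delta>, IsTy S')"
proof -
  let ?\<tau> = "inv \<sigma>"
  have \<tau>: "map ?\<tau> (map fst \<Delta>) = map fst \<Gamma>"
    using \<sigma> by (simp add: bij_is_inj flip: \<sigma>(1))
  from eq have len: "length \<Gamma> = length \<Delta>"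
    and eqs: "\<And>i. i \<le> length \<Gamma> \<Longrightarrow> (map snd \<Gamma> @ [S]) ! i =
       rename (take i (map fst \<Delta>)) (take i (map fst \<Gamma>)) ((map snd \<Delta> @ [S']) ! i)"
    by (auto elim!: equiv_judgements.cases simp: derived_free_EqTy[OF X])
  have "(map snd \<Gamma> @ [S]) ! i = map_expr ?\<tau> id ((map snd \<Delta> @ [S']) ! i)" if "i \<le> length \<Gamma>" for i
  proof -
    have "fv ((map snd \<Delta> @ [S']) ! i) \<subseteq> set (take i (map fst \<Delta>))"
      using derived_free_ctx_shape[OF X der(2)] derived_free_shape[OF X der(2)] that len
      by (cases "i = length \<Delta>") (auto simp: nth_append)
    then show ?thesis
      using eqs[OF that] rename_map[of _ "take i (map fst \<Delta>)" ?\<tau>] by (simp add: take_map flip: \<tau>)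
  qed
  note * = this
  have "S = map_expr ?\<tau> id S'" using *[of "length \<Gamma>"] len by (simp add: nth_append)
  moreover have "\<Gamma> = map (map_prod ?\<tau> (map_expr ?\<tau> id)) \<Delta>"
  proof (rule nth_equalityI)
    fix i assume i: "i < length \<Gamma>"
    have "fst (\<Gamma> ! i) = ?\<tau> (fst (\<Delta> ! i))"
      using arg_cong[OF \<tau>, of "\<lambda>xs. xs ! i"] i len by simp
    then show "\<Gamma> ! i = map (map_prod ?\<tau> (map_expr ?\<tau> id)) \<Delta> ! i"
      using *[of i] i len by (auto simp: nth_append prod_eq_iff)
  qed (simp add: len)
  ultimately have "(\<Gamma>, IsTy S) = permute ?\<tau> (\<Delta>, IsTy S')" by simp
  then show ?thesis
    using permute_inv[OF bij_imp_bij_inv[OF \<sigma>(2)], of "(\<Delta>, IsTy S')"] \<sigma>(2)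
    by (simp add: inv_inv_eq del: permute_simp)
qed

text \<open>Renaming back the \<open>i\<close>-th type of the renamed context gives the original one, so the required
  equalities are reflexivities; these are derivable because truncated contexts are.\<close>

lemma equiv_free_permute_ty:
  assumes X: "is_presheaf X" and der: "(\<Gamma>, IsTy S) \<in> derived (G_obj X)" and \<sigma>: "bij \<sigma>"
  shows "((\<Gamma>, IsTy S), permute \<sigma> (\<Gamma>, IsTy S)) \<in> equiv_judgements (G_obj X)"
proof -
  have "(take i \<Gamma>, EqTy ((map snd \<Gamma> @ [S]) ! i)
     (rename (take i (map \<sigma> (map fst \<Gamma>))) (take i (map fst \<Gamma>))
       (map_expr \<sigma> id ((map snd \<Gamma> @ [S]) ! i)))) \<in> derived (G_obj X)" if i: "i \<le> length \<Gamma>" for i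
  proof -
    let ?T = "(map snd \<Gamma> @ [S]) ! i"
    have T: "(take i \<Gamma>, IsTy ?T) \<in> derived (G_obj X)"
      using der derived_take[OF der, of i] i by (cases "i = length \<Gamma>") (auto simp: nth_append)
    then have "fv ?T \<subseteq> set (take i (map fst \<Gamma>))"
      using derived_free_shape[OF X T] by (simp add: take_map)
    then have "rename (take i (map \<sigma> (map fst \<Gamma>))) (take i (map fst \<Gamma>)) (map_expr \<sigma> id ?T) = ?T"
      using rename_inv[OF \<sigma>, of ?T "take i (map fst \<Gamma>)"] by (simp only: take_map)
    then show ?thesis using T by (simp add: derived_free_EqTy[OF X])
  qed
  moreover have "(map snd (map (map_prod \<sigma> (map_expr \<sigma> id)) \<Gamma>) @ [map_expr \<sigma> id S]) ! i
      = map_expr \<sigma> id ((map snd \<Gamma> @ [S]) ! i)" if "i \<le> length \<Gamma>" for i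
    using that by (auto simp: nth_append)
  moreover have "map fst (map (map_prod \<sigma> (map_expr \<sigma> id)) \<Gamma>) = map \<sigma> (map fst \<Gamma>)" by simp
  ultimately show ?thesis
    using der derived_permute[OF der \<sigma>]
    unfolding permute_simp rhs.map
    by (intro equiv_judgements.ty) (simp_all del: map_append map_map)
qed

text \<open>This replaces equivalence by an orbit relation. That the latter is symmetric and transitive, and
  that equivariant maps preserve it, comes from the group of bijections.\<close>

lemma equiv_free:
  assumes X: "is_presheaf X"
  shows "(J, K) \<in> equiv_judgements (G_obj X) \<longleftrightarrow>
    J \<in> derived (G_obj X) \<and> (is_ty (snd J) \<or> is_tm (snd J)) \<and> (\<exists>\<sigma>. bij \<sigma> \<and> K = permute \<sigma> J)"
    (is "?L \<longleftrightarrow> ?R")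
proof
  have ex: "\<exists>\<sigma>. bij \<sigma> \<and> map \<sigma> (map fst \<Gamma>) = map fst \<Delta>"
    if "(\<Gamma>, R) \<in> derived (G_obj X)" "(\<Delta>, R') \<in> derived (G_obj X)" "length \<Gamma> = length \<Delta>" for \<Gamma> \<Delta> R R'
    using derived_free_shape[OF X that(1)] derived_free_shape[OF X that(2)] that(3)
    by (intro ex_bij_map_eq) simp_all
  assume L: ?L
  obtain \<Gamma> R \<Delta> R' where [simp]: "J = (\<Gamma>, R)" "K = (\<Delta>, R')" by (cases J, cases K)
  from L have "((\<Gamma>, R), (\<Delta>, R')) \<in> equiv_judgements (G_obj X)" by simp
  then show ?R
  proof cases
    case (ty S S')
    obtain \<sigma> where \<sigma>: "bij \<sigma>" "map \<sigma> (map fst \<Gamma>) = map fst \<Delta>"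
      using ex[OF ty(3,4,5)] by blast
    have "permute \<sigma> (\<Gamma>, IsTy S) = (\<Delta>, IsTy S')"
      using L ty(1,2) by (intro equiv_free_ty_permute[OF X ty(3,4) _ \<sigma>(2,1)]) simp
    then show ?thesis using ty(1-3) \<sigma>(1) by (intro conjI exI[of _ \<sigma>]) simp_all
  next
    case (tm s S t S')
    have S: "(\<Gamma>, IsTy S) \<in> derived (G_obj X)" "(\<Delta>, IsTy S') \<in> derived (G_obj X)"
      and len: "length \<Gamma> = length \<Delta>"
      using tm(5) by (cases; simp)+
    obtain \<sigma> where \<sigma>: "bij \<sigma>" "map \<sigma> (map fst \<Gamma>) = map fst \<Delta>"
      using ex[OF S len] by blast
    have 1: "permute \<sigma> (\<Gamma>, IsTy S) = (\<Delta>, IsTy S')"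
      by (rule equiv_free_ty_permute[OF X S tm(5) \<sigma>(2,1)])
    have "map (inv \<sigma>) (map fst \<Delta>) = map fst \<Gamma>"
      using \<sigma>(1) by (simp add: bij_is_inj flip: \<sigma>(2))
    moreover have "s = rename (map fst \<Delta>) (map fst \<Gamma>) t"
      using tm(6) by (simp add: derived_free_EqTm[OF X])
    moreover have "fv t \<subseteq> set (map fst \<Delta>)"
      using derived_free_shape[OF X tm(4)] by simp
    ultimately have "s = map_expr (inv \<sigma>) id t"
      using rename_map by metis
    then have "map_expr \<sigma> id s = t"
      using map_expr_inv[OF bij_imp_bij_inv[OF \<sigma>(1)]] \<sigma>(1) by (simp add: inv_inv_eq)
    then show ?thesis using 1 \<sigma>(1) tm(1-3) by (intro conjI exI[of _ \<sigma>]) simp_all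
  qed
next
  assume ?R
  then obtain \<sigma> where J: "J \<in> derived (G_obj X)" and R: "is_ty (snd J) \<or> is_tm (snd J)"
    and \<sigma>: "bij \<sigma>" "K = permute \<sigma> J" by blast
  obtain \<Gamma> R where [simp]: "J = (\<Gamma>, R)" by (cases J)
  show ?L
  proof (cases R)
    case (IsTy S)
    then show ?thesis using equiv_free_permute_ty[OF X _ \<sigma>(1)] J \<sigma>(2) by simp
  next
    case (HasTm s S)
    then have der: "(\<Gamma>, HasTm s S) \<in> derived (G_obj X)" using J by simp
    have S: "(\<Gamma>, IsTy S) \<in> derived (G_obj X)"
      using derived_boundary[OF der, of "(\<Gamma>, IsTy S)"] by simp
    have "fv s \<subseteq> set (map fst \<Gamma>)" using derived_free_shape[OF X der] by simp
    then have "(\<Gamma>, EqTm s (rename (map \<sigma> (map fst \<Gamma>)) (map fst \<Gamma>) (map_expr \<sigma> id s)) S) \<in> derived (G_obj X)"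
      using rename_inv[OF \<sigma>(1), of s "map fst \<Gamma>"] der
      by (simp add: derived_free_EqTm[OF X])
    then have "((\<Gamma>, HasTm s S), (map (map_prod \<sigma> (map_expr \<sigma> id)) \<Gamma>,
        HasTm (map_expr \<sigma> id s) (map_expr \<sigma> id S))) \<in> equiv_judgements (G_obj X)"
      using der derived_permute[OF der \<sigma>(1)] equiv_free_permute_ty[OF X S \<sigma>(1)]
      by (intro equiv_judgements.tm) simp_all
    then show ?thesis using HasTm \<sigma>(2) by simp
  qed (use R in auto)
qed


lemma equiv_free_refl:
  assumes X: "is_presheaf X" and J: "J \<in> derived (G_obj X)" "is_ty (snd J) \<or> is_tm (snd J)"
  shows "(J, J) \<in> equiv_judgements (G_obj X)"
  using J unfolding equiv_free[OF X] by (intro conjI exI[of _ id] bij_id) simp_all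

lemma equiv_free_class_eq:
  assumes X: "is_presheaf X" and JK: "(J, K) \<in> equiv_judgements (G_obj X)"
  shows "equiv_judgements (G_obj X) `` {K} = equiv_judgements (G_obj X) `` {J}"
proof -
  from JK obtain \<sigma> where J: "J \<in> derived (G_obj X)" "is_ty (snd J) \<or> is_tm (snd J)"
    and \<sigma>: "bij \<sigma>" "K = permute \<sigma> J" unfolding equiv_free[OF X] by (elim conjE exE)
  have "(K, L) \<in> equiv_judgements (G_obj X) \<longleftrightarrow> (J, L) \<in> equiv_judgements (G_obj X)" for L
  proof
    assume "(K, L) \<in> equiv_judgements (G_obj X)"
    then obtain \<tau> where "bij \<tau>" "L = permute \<tau> K" unfolding equiv_free[OF X] by (elim conjE exE)
    then show "(J, L) \<in> equiv_judgements (G_obj X)"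
      using J \<sigma> unfolding equiv_free[OF X]
      by (intro conjI exI[of _ "\<tau> \<circ> \<sigma>"] bij_comp) (simp_all add: permute_permute)
  next
    assume "(J, L) \<in> equiv_judgements (G_obj X)"
    then obtain \<tau> where "bij \<tau>" "L = permute \<tau> J" unfolding equiv_free[OF X] by (elim conjE exE)
    then have "bij (\<tau> \<circ> inv \<sigma>)" "L = permute (\<tau> \<circ> inv \<sigma>) K"
      using \<sigma> by (simp_all add: permute_inv bij_comp bij_imp_bij_inv flip: permute_permute)
    then show "(K, L) \<in> equiv_judgements (G_obj X)"
      using J \<sigma> unfolding equiv_free[OF X]
      by (intro conjI exI[of _ "\<tau> \<circ> inv \<sigma>"]) (simp_all add: derived_permute)
  qed
  then show ?thesis by (intro set_eqI) simp
qed

section \<open>The structure of classes of judgements of a free theory\<close>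

lemma W_ty_I:
  "J \<in> derived (G_obj X) \<Longrightarrow> is_ty (snd J) \<Longrightarrow> degree J = n \<Longrightarrow>
    equiv_judgements (G_obj X) `` {J} \<in> Ty (W_obj X) n"
  by (auto simp: V_obj_def intro: quotientI)

lemma W_tm_I:
  "J \<in> derived (G_obj X) \<Longrightarrow> is_tm (snd J) \<Longrightarrow> degree J = n \<Longrightarrow>
    equiv_judgements (G_obj X) `` {J} \<in> Tm (W_obj X) n"
  by (auto simp: V_obj_def intro: quotientI)

lemma W_ty_D:
  assumes X: "is_presheaf X" and C: "C \<in> Ty (W_obj X) n" "J \<in> C"
  shows "J \<in> derived (G_obj X)" "is_ty (snd J)" "degree J = n" "C = equiv_judgements (G_obj X) `` {J}"
proof -
  from C(1) obtain J' where J': "J' \<in> derived (G_obj X)" "is_ty (snd J')" "degree J' = n"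
    "C = equiv_judgements (G_obj X) `` {J'}" by (auto simp: V_obj_def elim!: quotientE)
  then have E: "(J', J) \<in> equiv_judgements (G_obj X)" using C(2) by simp
  then obtain \<sigma> where "bij \<sigma>" "J = permute \<sigma> J'" unfolding equiv_free[OF X] by (elim conjE exE)
  with J' equiv_free_class_eq[OF X E]
  show "J \<in> derived (G_obj X)" "is_ty (snd J)" "degree J = n" "C = equiv_judgements (G_obj X) `` {J}"
    by (simp_all add: derived_permute)
qed

lemma W_tm_D:
  assumes X: "is_presheaf X" and C: "C \<in> Tm (W_obj X) n" "J \<in> C"
  shows "J \<in> derived (G_obj X)" "is_tm (snd J)" "degree J = n" "C = equiv_judgements (G_obj X) `` {J}"
proof -
  from C(1) obtain J' where J': "J' \<in> derived (G_obj X)" "is_tm (snd J')" "degree J' = n"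
    "C = equiv_judgements (G_obj X) `` {J'}" by (auto simp: V_obj_def elim!: quotientE)
  then have E: "(J', J) \<in> equiv_judgements (G_obj X)" using C(2) by simp
  then obtain \<sigma> where "bij \<sigma>" "J = permute \<sigma> J'" unfolding equiv_free[OF X] by (elim conjE exE)
  with J' equiv_free_class_eq[OF X E]
  show "J \<in> derived (G_obj X)" "is_tm (snd J)" "degree J = n" "C = equiv_judgements (G_obj X) `` {J}"
    by (simp_all add: derived_permute)
qed

text \<open>Such a representative can be compared with a basic judgement of a free theory, which has these
  variables, without any renaming.\<close>

lemma ex_standard_variables:
  assumes X: "is_presheaf X" and J: "J \<in> derived (G_obj X)" "is_ty (snd J) \<or> is_tm (snd J)" "degree J = n"
  shows "\<exists>K\<in>equiv_judgements (G_obj X) `` {J}. map fst (fst K) = [1..<n]"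
proof -
  obtain \<Gamma> R where [simp]: "J = (\<Gamma>, R)" by (cases J)
  have "distinct (map fst \<Gamma>)" using derived_free_shape[OF X, of \<Gamma> R] J(1) by simp
  then obtain \<sigma> where \<sigma>: "bij \<sigma>" "map \<sigma> (map fst \<Gamma>) = [1..<n]"
    using ex_bij_map_eq[of "map fst \<Gamma>" "[1..<n]"] J(3) by (auto simp: degree_def)
  then have "map fst (fst (permute \<sigma> J)) = [1..<n]" by (simp add: comp_def)
  moreover have "(J, permute \<sigma> J) \<in> equiv_judgements (G_obj X)"
    using J(1,2) \<sigma>(1) unfolding equiv_free[OF X] by (intro conjI exI[of _ \<sigma>]) simp_all
  ultimately show ?thesis by (intro bexI[of _ "permute \<sigma> J"]) simp_all
qed

lemma W_ty_standard:
  assumes X: "is_presheaf X" and C: "C \<in> Ty (W_obj X) n"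
  shows "\<exists>\<Gamma> S. (\<Gamma>, IsTy S) \<in> C \<and> map fst \<Gamma> = [1..<n]"
proof -
  from C obtain J where J: "J \<in> derived (G_obj X)" "is_ty (snd J)" "degree J = n"
    "C = equiv_judgements (G_obj X) `` {J}" by (auto simp: V_obj_def elim!: quotientE)
  then obtain K where K: "K \<in> C" "map fst (fst K) = [1..<n]"
    using ex_standard_variables[OF X J(1) _ J(3)] by auto
  with W_ty_D(2)[OF X C K(1)] show ?thesis by (cases K; cases "snd K") auto
qed

lemma W_tm_standard:
  assumes X: "is_presheaf X" and C: "C \<in> Tm (W_obj X) n"
  shows "\<exists>\<Gamma> s S. (\<Gamma>, HasTm s S) \<in> C \<and> map fst \<Gamma> = [1..<n]"
proof -
  from C obtain J where J: "J \<in> derived (G_obj X)" "is_tm (snd J)" "degree J = n"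
    "C = equiv_judgements (G_obj X) `` {J}" by (auto simp: V_obj_def elim!: quotientE)
  then obtain K where K: "K \<in> C" "map fst (fst K) = [1..<n]"
    using ex_standard_variables[OF X J(1) _ J(3)] by auto
  with W_tm_D(2)[OF X C K(1)] show ?thesis by (cases K; cases "snd K") auto
qed

text \<open>Boundaries commute with renaming, so the union that defines the boundary of a class consists of
  copies of a single class.\<close>

lemma boundary_class:
  assumes X: "is_presheaf X" and J: "J \<in> derived (G_obj X)" "is_ty (snd J) \<or> is_tm (snd J)"
    and bd: "boundary J = [K]" "is_ty (snd K)"
  shows "(\<Union>J'\<in>equiv_judgements (G_obj X) `` {J}. equiv_judgements (G_obj X) `` set (boundary J')) =
    equiv_judgements (G_obj X) `` {K}"
proof -
  have K: "K \<in> derived (G_obj X)" using derived_boundary[OF J(1)] bd(1) by simp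
  have "equiv_judgements (G_obj X) `` set (boundary J') = equiv_judgements (G_obj X) `` {K}"
    if "(J, J') \<in> equiv_judgements (G_obj X)" for J'
  proof -
    from that obtain \<sigma> where \<sigma>: "bij \<sigma>" "J' = permute \<sigma> J" unfolding equiv_free[OF X] by (elim conjE exE)
    then have "(K, permute \<sigma> K) \<in> equiv_judgements (G_obj X)"
      using K bd(2) unfolding equiv_free[OF X] by (intro conjI exI[of _ \<sigma>]) simp_all
    then show ?thesis using \<sigma> bd(1) equiv_free_class_eq[OF X] by (simp add: boundary_permute)
  qed
  moreover have "(J, J) \<in> equiv_judgements (G_obj X)" by (rule equiv_free_refl[OF X J])
  ultimately show ?thesis by (intro equalityI UN_least) auto
qed

lemma bdTy_W:
  assumes X: "is_presheaf X" and der: "(\<Gamma> @ [(x, S)], IsTy T) \<in> derived (G_obj X)"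
  shows "bdTy (W_obj X) n (equiv_judgements (G_obj X) `` {(\<Gamma> @ [(x, S)], IsTy T)}) =
    equiv_judgements (G_obj X) `` {(\<Gamma>, IsTy S)}"
  using boundary_class[OF X der] by (simp add: V_obj_def)

lemma bdTm_W:
  assumes X: "is_presheaf X" and der: "(\<Gamma>, HasTm s S) \<in> derived (G_obj X)"
  shows "bdTm (W_obj X) n (equiv_judgements (G_obj X) `` {(\<Gamma>, HasTm s S)}) =
    equiv_judgements (G_obj X) `` {(\<Gamma>, IsTy S)}"
  using boundary_class[OF X der] by (simp add: V_obj_def)

lemma is_presheaf_W:
  assumes X: "is_presheaf X"
  shows "is_presheaf (W_obj X)"
proof -
  have "bdTy (W_obj X) n C \<in> Ty (W_obj X) n" if n: "n \<ge> 1" and C: "C \<in> Ty (W_obj X) (Suc n)" for n C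
  proof -
    obtain \<Gamma> S where J: "(\<Gamma>, IsTy S) \<in> C" "map fst \<Gamma> = [1..<Suc n]"
      using W_ty_standard[OF X C] by (elim exE conjE)
    then have "\<Gamma> \<noteq> []" using n by auto
    then obtain \<Gamma>' x T where \<Gamma>: "\<Gamma> = \<Gamma>' @ [(x, T)]" by (metis rev_exhaust surj_pair)
    have der: "(\<Gamma>' @ [(x, T)], IsTy S) \<in> derived (G_obj X)" using W_ty_D(1)[OF X C J(1)] \<Gamma> by simp
    have "length \<Gamma> = n" using arg_cong[OF J(2), of length] by simp
    then show ?thesis
      using bdTy_W[OF X der, of n] W_ty_D(4)[OF X C J(1)] \<Gamma> derived_last[OF der]
      by (auto intro!: W_ty_I simp: degree_def)
  qed
  moreover have "bdTm (W_obj X) n C \<in> Ty (W_obj X) n" if C: "C \<in> Tm (W_obj X) n" for n C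
  proof -
    obtain \<Gamma> s S where J: "(\<Gamma>, HasTm s S) \<in> C" "map fst \<Gamma> = [1..<n]"
      using W_tm_standard[OF X C] by (elim exE conjE)
    have der: "(\<Gamma>, HasTm s S) \<in> derived (G_obj X)" using W_tm_D(1)[OF X C J(1)] .
    show ?thesis
      using bdTm_W[OF X der, of n] W_tm_D(3,4)[OF X C J(1)] derived_boundary[OF der, of "(\<Gamma>, IsTy S)"]
      by (auto intro!: W_ty_I simp: degree_def)
  qed
  ultimately show ?thesis by (auto simp: is_presheaf_def)
qed

section \<open>Substituting judgements for constants\<close>

text \<open>The expression that is substituted for a constant: the type of a type judgement, the term of a
  term judgement. The values at equalities are arbitrary.\<close>

fun subject :: "('v, 'w) rhs \<Rightarrow> ('v, 'w) expr" where
  "subject (IsTy T) = T"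
| "subject (HasTm t T) = t"
| "subject (EqTy T T') = T"
| "subject (EqTm t t' T) = t"

definition constant_class :: "(nat \<times> 'c) + (nat \<times> 'c) \<Rightarrow> 'c" where
  "constant_class c = snd (case_sum id id c)"

definition the_var :: "('v, 'w) expr \<Rightarrow> 'v" where
  "the_var t = (case t of Var v \<Rightarrow> v)"

text \<open>A constant is a degree and a class \<open>C\<close>. Its application to variables becomes the subject of a chosen
  member of \<open>C\<close>, with the arguments substituted for the variables of its context; by \<open>inst_App\<close> the
  choice does not matter. Only flat expressions occur, so there is no recursion.\<close>

fun inst ::
  "(nat \<times> ('o, 's) judgement set, nat \<times> ('o, 's) judgement set) exp \<Rightarrow> ('o, 's) exp" where
  "inst (Var v) = Var v"
| "inst (App c ts) = (let J = SOME J. J \<in> constant_class c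
     in rename (map fst (fst J)) (map the_var ts) (subject (snd J)))"

primrec inst_rhs ::
  "(var, (nat \<times> ('o, 's) judgement set) + (nat \<times> ('o, 's) judgement set)) rhs \<Rightarrow> (var, 'o + 's) rhs"
  where
  "inst_rhs (IsTy T) = IsTy (inst T)"
| "inst_rhs (HasTm t T) = HasTm (inst t) (inst T)"
| "inst_rhs (EqTy T T') = EqTy (inst T) (inst T')"
| "inst_rhs (EqTm t t' T) = EqTm (inst t) (inst t') (inst T)"

definition inst_judgement ::
  "(nat \<times> ('o, 's) judgement set, nat \<times> ('o, 's) judgement set) judgement \<Rightarrow> ('o, 's) judgement"
  where
  "inst_judgement = (\<lambda>(\<Gamma>, R). (map (map_prod id inst) \<Gamma>, inst_rhs R))"

lemma subject_map: "subject (map_rhs \<sigma> id R) = map_expr \<sigma> id (subject R)"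
  by (cases R) simp_all

lemma fv_subject: "fv (subject R) \<subseteq> rhs_fv R"
  by (cases R) auto

lemma the_var_Var [simp]: "the_var (Var v) = v"
  by (simp add: the_var_def)

text \<open>Independence of the representative: the chosen one is the renaming of \<open>\<Delta>\<close> by some bijection \<open>\<sigma>\<close>,
  and the arguments \<open>\<rho>(\<Delta>)\<close> are \<open>\<rho> \<circ> \<sigma>\<^sup>-\<^sup>1\<close> applied to its variables, so \<open>\<sigma>\<close> cancels.\<close>

lemma inst_App:
  assumes X: "is_presheaf X" and der: "(\<Delta>, R) \<in> derived (G_obj X)" "is_ty R \<or> is_tm R"
    and c: "constant_class c = equiv_judgements (G_obj X) `` {(\<Delta>, R)}"
    and \<rho>: "vs = map \<rho> (map fst \<Delta>)"
  shows "inst (App c (map Var vs)) = map_expr \<rho> id (subject R)"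
proof -
  have "(\<Delta>, R) \<in> constant_class c" using equiv_free_refl[OF X der(1)] der(2) c by simp
  then have "(SOME J. J \<in> constant_class c) \<in> constant_class c" by (rule someI)
  then obtain \<sigma> where \<sigma>: "bij \<sigma>" "(SOME J. J \<in> constant_class c) = permute \<sigma> (\<Delta>, R)"
    unfolding c Image_singleton_iff equiv_free[OF X] by (elim conjE exE)
  have fv: "fv (subject R) \<subseteq> set (map fst \<Delta>)"
    using derived_free_shape[OF X der(1)] fv_subject[of R] by auto
  have vs: "vs = map (\<rho> \<circ> inv \<sigma>) (map \<sigma> (map fst \<Delta>))"
    using \<sigma>(1) by (simp add: \<rho> bij_is_inj)
  have "inst (App c (map Var vs)) = rename (map \<sigma> (map fst \<Delta>)) vs (map_expr \<sigma> id (subject R))"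
    using \<sigma>(2) by (simp add: subject_map comp_def)
  also have "\<dots> = map_expr (\<rho> \<circ> inv \<sigma>) id (map_expr \<sigma> id (subject R))"
    unfolding vs using fv by (intro rename_map) (auto simp: expr.set_map)
  also have "\<dots> = map_expr \<rho> id (subject R)"
    using \<sigma>(1) by (simp add: expr.map_comp comp_assoc bij_is_inj)
  finally show ?thesis .
qed

text \<open>The result depends on the arguments only through substitution, which commutes with renaming them,
  and the representative has no free variables besides those substituted for.\<close>

lemma inst_equivariant:
  assumes X: "is_presheaf X" and T: "ty_shape (W_obj X) T \<or> tm_shape (W_obj X) T"
  shows "inst (map_expr \<sigma> id T) = map_expr \<sigma> id (inst T) \<and> fv (inst T) \<subseteq> fv T"
proof -
  have *: ?thesis
    if T: "T = App c (map Var vs)" and der: "(\<Delta>, R) \<in> derived (G_obj X)" "is_ty R \<or> is_tm R"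
      and c: "constant_class c = equiv_judgements (G_obj X) `` {(\<Delta>, R)}"
      and len: "length vs = length \<Delta>"
    for c vs \<Delta> R
  proof -
    have dist: "distinct (map fst \<Delta>)" and fv: "fv (subject R) \<subseteq> set (map fst \<Delta>)"
      using derived_free_shape[OF X der(1)] fv_subject[of R] by auto
    obtain \<rho> where \<rho>: "vs = map \<rho> (map fst \<Delta>)"
      using ex_map_eq[OF dist, of vs] len by auto
    have 1: "inst T = map_expr \<rho> id (subject R)"
      unfolding T by (rule inst_App[OF X der c \<rho>])
    have "inst (App c (map Var (map \<sigma> vs))) = map_expr (\<sigma> \<circ> \<rho>) id (subject R)"
      by (rule inst_App[OF X der c]) (simp add: \<rho>)
    then have "inst (map_expr \<sigma> id T) = map_expr \<sigma> id (inst T)"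
      using 1 T by (simp add: expr.map_comp comp_def id_def del: inst.simps)
    moreover have "fv (inst T) = \<rho> ` fv (subject R)" unfolding 1 by (simp add: expr.set_map)
    moreover have "fv T = \<rho> ` set (map fst \<Delta>)" by (auto simp: T \<rho>)
    ultimately show ?thesis using image_mono[OF fv, of \<rho>] by metis
  qed
  from T show ?thesis
  proof
    assume "ty_shape (W_obj X) T"
    then obtain k C vs where C: "T = App (Inl (k, C)) (map Var vs)" "C \<in> Ty (W_obj X) k" "k = Suc (length vs)"
      unfolding ty_shape_def by (elim exE conjE)
    obtain \<Gamma> S where J: "(\<Gamma>, IsTy S) \<in> C" using W_ty_standard[OF X C(2)] by (elim exE conjE)
    show ?thesis
      using W_ty_D[OF X C(2) J] C(3)
      by (intro *[OF C(1), of \<Gamma> "IsTy S"]) (simp_all add: constant_class_def degree_def)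
  next
    assume "tm_shape (W_obj X) T"
    then obtain k C vs where C: "T = App (Inr (k, C)) (map Var vs)" "C \<in> Tm (W_obj X) k" "k = Suc (length vs)"
      unfolding tm_shape_def by (elim exE conjE)
    obtain \<Gamma> s S where J: "(\<Gamma>, HasTm s S) \<in> C" using W_tm_standard[OF X C(2)] by (elim exE conjE)
    show ?thesis
      using W_tm_D[OF X C(2) J] C(3)
      by (intro *[OF C(1), of \<Gamma> "HasTm s S"]) (simp_all add: constant_class_def degree_def)
  qed
qed


lemma inst_judgement_simp [simp]:
  "inst_judgement (\<Gamma>, R) = (map (map_prod id inst) \<Gamma>, inst_rhs R)"
  by (simp add: inst_judgement_def)

lemma map_fst_inst_judgement: "map fst (fst (inst_judgement J)) = map fst (fst J)"
  by (cases J) simp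

lemma boundary_inst_judgement: "boundary (inst_judgement J) = map inst_judgement (boundary J)"
proof -
  obtain \<Gamma> R where "J = (\<Gamma>, R)" by (cases J)
  then show ?thesis by (cases R) (simp_all add: map_butlast last_map)
qed

lemma derived_free_mem_shape:
  assumes "is_presheaf X" "(\<Gamma>, R) \<in> derived (G_obj X)" "p \<in> set \<Gamma>"
  shows "ty_shape X (snd p)"
  using derived_free_ctx_shape[OF assms(1,2)] assms(3) by (auto simp: in_set_conv_nth)

lemma inst_judgement_permute:
  assumes X: "is_presheaf X" and J: "J \<in> derived (G_obj (W_obj X))"
  shows "inst_judgement (permute \<sigma> J) = permute \<sigma> (inst_judgement J)"
proof -
  obtain \<Gamma> R where [simp]: "J = (\<Gamma>, R)" by (cases J)
  note W = is_presheaf_W[OF X]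
  have "inst (map_expr \<sigma> id (snd p)) = map_expr \<sigma> id (inst (snd p))" if "p \<in> set \<Gamma>" for p
    using inst_equivariant[OF X] derived_free_mem_shape[OF W _ that, of R] J by simp
  moreover have "inst_rhs (map_rhs \<sigma> id R) = map_rhs \<sigma> id (inst_rhs R)"
    using derived_free_shape[OF W, of \<Gamma> R] J inst_equivariant[OF X] by (cases R) simp_all
  ultimately show ?thesis by (simp add: prod_eq_iff)
qed

lemma ctx_fv_inst:
  assumes X: "is_presheaf X" and \<Gamma>: "\<And>p. p \<in> set \<Gamma> \<Longrightarrow> ty_shape (W_obj X) (snd p)"
  shows "ctx_fv (map (map_prod id inst) \<Gamma>) \<subseteq> ctx_fv \<Gamma>"
proof -
  have "insert (fst p) (fv (inst (snd p))) \<subseteq> ctx_fv \<Gamma>" if p: "p \<in> set \<Gamma>" for p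
  proof -
    have "insert (fst p) (fv (inst (snd p))) \<subseteq> insert (fst p) (fv (snd p))"
      using inst_equivariant[OF X, of "snd p"] \<Gamma>[OF p] by auto
    also have "\<dots> \<subseteq> ctx_fv \<Gamma>"
      using p unfolding ctx_fv_def split_beta by (rule UN_upper)
    finally show ?thesis .
  qed
  then show ?thesis by (auto simp: ctx_fv_def split_beta)
qed

text \<open>All rules but renaming and weakening are schematic in expressions. Renaming uses equivariance;
  for weakening, a variable fresh for a context is fresh for its image.\<close>

lemma step_inst_judgement:
  assumes X: "is_presheaf X" and Js: "set Js \<subseteq> derived (G_obj (W_obj X))" and "step r Js J"
  shows "step r (map inst_judgement Js) (inst_judgement J)"
  using assms(3)
proof cases
  case (9 \<sigma> K)
  then show ?thesis
    using Js inst_judgement_permute[OF X, of K] by (simp add: step.intros(9))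
next
  case (10 y \<Gamma> \<Delta> T R)
  have "ty_shape (W_obj X) (snd p)" if "p \<in> set (\<Gamma> @ \<Delta>)" for p
    using derived_free_mem_shape[OF is_presheaf_W[OF X] _ that, of R] Js 10 by simp
  then have "y \<notin> ctx_fv (map (map_prod id inst) \<Gamma>) \<union> ctx_fv (map (map_prod id inst) \<Delta>)"
    using ctx_fv_inst[OF X, of \<Gamma>] ctx_fv_inst[OF X, of \<Delta>] 10(4) by auto
  then show ?thesis by (simp add: 10 step.intros(10))
qed (simp_all add: step.intros)

lemma inst_standard:
  assumes X: "is_presheaf X" and der: "(\<Gamma>, R) \<in> derived (G_obj X)" "is_ty R \<or> is_tm R"
    and c: "constant_class c = equiv_judgements (G_obj X) `` {(\<Gamma>, R)}"
    and vars: "map fst \<Gamma> = [1..<n]"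
  shows "inst (App c (map Var [1..<n])) = subject R"
proof -
  have "inst (App c (map Var [1..<n])) = map_expr id id (subject R)"
    by (rule inst_App[OF X der c]) (simp add: vars)
  then show ?thesis by (simp add: expr.map_id)
qed

text \<open>By induction on the degree: the context of the basic judgement of \<open>C\<close> ends with the basic
  judgement of \<open>\<partial>C\<close>, and the truncation of a representative of \<open>C\<close> represents \<open>\<partial>C\<close>.\<close>

lemma inst_free_ty:
  assumes X: "is_presheaf X"
  shows "n \<ge> 1 \<Longrightarrow> C \<in> Ty (W_obj X) n \<Longrightarrow> (\<Gamma>, IsTy S) \<in> C \<Longrightarrow> map fst \<Gamma> = [1..<n] \<Longrightarrow>
    inst_judgement (free_ty (W_obj X) n C) = (\<Gamma>, IsTy S)"
proof (induction n arbitrary: C \<Gamma> S rule: nat_induct_at_least)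
  case base
  have "inst (free_expr_ty 1 C) = S"
    using inst_standard[OF X W_ty_D(1)[OF X base(1,2)] _ _ base(3), of "Inl (1, C)"]
      W_ty_D(4)[OF X base(1,2)]
    by (simp add: free_expr_ty_def constant_class_def del: inst.simps)
  then show ?case using base(3) by (simp add: free_ty_def)
next
  case (Suc n)
  have S: "inst (free_expr_ty (Suc n) C) = S"
    using inst_standard[OF X W_ty_D(1)[OF X Suc.prems(1,2)] _ _ Suc.prems(3), of "Inl (Suc n, C)"]
      W_ty_D(4)[OF X Suc.prems(1,2)]
    by (simp add: free_expr_ty_def constant_class_def del: inst.simps upt_Suc)
  have "\<Gamma> \<noteq> []" using Suc.prems(3) Suc.hyps by auto
  then obtain \<Gamma>' x S' where \<Gamma>: "\<Gamma> = \<Gamma>' @ [(x, S')]" by (metis rev_exhaust surj_pair)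
  then have vars: "map fst \<Gamma>' = [1..<n]" "x = n" using Suc.prems(3) Suc.hyps by simp_all
  have der: "(\<Gamma>' @ [(x, S')], IsTy S) \<in> derived (G_obj X)"
    using W_ty_D(1)[OF X Suc.prems(1,2)] \<Gamma> by simp
  have bd: "bdTy (W_obj X) n C = equiv_judgements (G_obj X) `` {(\<Gamma>', IsTy S')}"
    using bdTy_W[OF X der, of n] W_ty_D(4)[OF X Suc.prems(1,2)] \<Gamma> by simp
  have "(\<Gamma>', IsTy S') \<in> bdTy (W_obj X) n C"
    unfolding bd using equiv_free_refl[OF X, of "(\<Gamma>', IsTy S')"] derived_last[OF der] by simp
  then have "inst_judgement (free_ty (W_obj X) n (bdTy (W_obj X) n C)) = (\<Gamma>', IsTy S')"
    using presheaf_bdTy[OF is_presheaf_W[OF X] Suc.hyps Suc.prems(1)] vars(1) by (intro Suc.IH)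
  then show ?case
    using S Suc.hyps by (simp add: free_ty_def free_ctx_Suc \<Gamma> vars(2))
qed

lemma inst_free_tm:
  assumes X: "is_presheaf X" and n: "n \<ge> 1" and C: "C \<in> Tm (W_obj X) n" "(\<Gamma>, HasTm s S) \<in> C"
    and vars: "map fst \<Gamma> = [1..<n]"
  shows "inst_judgement (free_tm (W_obj X) n C) = (\<Gamma>, HasTm s S)"
proof -
  note der = W_tm_D(1)[OF X C] and cls = W_tm_D(4)[OF X C]
  have s: "inst (App (Inr (n, C)) (map Var [1..<n])) = s"
    using inst_standard[OF X der _ _ vars, of "Inr (n, C)"] cls
    by (simp add: constant_class_def del: inst.simps)
  have bd: "bdTm (W_obj X) n C = equiv_judgements (G_obj X) `` {(\<Gamma>, IsTy S)}"
    using bdTm_W[OF X der, of n] cls by simp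
  have "(\<Gamma>, IsTy S) \<in> bdTm (W_obj X) n C"
    unfolding bd using equiv_free_refl[OF X, of "(\<Gamma>, IsTy S)"] derived_boundary[OF der] by simp
  then have "inst_judgement (free_ty (W_obj X) n (bdTm (W_obj X) n C)) = (\<Gamma>, IsTy S)"
    using presheaf_bdTm[OF is_presheaf_W[OF X] n C(1)] vars n by (intro inst_free_ty[OF X])
  then show ?thesis using s by (simp add: free_ty_def free_tm_def del: inst.simps)
qed

lemma derived_inst_judgement:
  assumes X: "is_presheaf X" and "J \<in> derived (G_obj (W_obj X))"
  shows "inst_judgement J \<in> derived (G_obj X)"
  using assms(2)
proof (induction rule: derived.induct)
  case (rule r Js J)
  then have "step r (map inst_judgement Js) (inst_judgement J)"
    by (intro step_inst_judgement[OF X]) auto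
  then show ?case using rule.IH by (intro derived.rule[of r "map inst_judgement Js"]) simp_all
next
  case (basic J)
  have ty: "inst_judgement (free_ty (W_obj X) n C) \<in> derived (G_obj X)"
    if n: "n \<ge> 1" and C: "C \<in> Ty (W_obj X) n" for n C
  proof -
    obtain \<Gamma> S where J: "(\<Gamma>, IsTy S) \<in> C" "map fst \<Gamma> = [1..<n]"
      using W_ty_standard[OF X C] by (elim exE conjE)
    show ?thesis using inst_free_ty[OF X n C J] W_ty_D(1)[OF X C J(1)] by simp
  qed
  have tm: "inst_judgement (free_tm (W_obj X) n C) \<in> derived (G_obj X)"
    if n: "n \<ge> 1" and C: "C \<in> Tm (W_obj X) n" for n C
  proof -
    obtain \<Gamma> s S where J: "(\<Gamma>, HasTm s S) \<in> C" "map fst \<Gamma> = [1..<n]"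
      using W_tm_standard[OF X C] by (elim exE conjE)
    show ?thesis using inst_free_tm[OF X n C J] W_tm_D(1)[OF X C J(1)] by simp
  qed
  from basic.hyps ty tm show ?case unfolding Basic_G_obj by blast
qed

lemma is_interpretation_inst:
  assumes X: "is_presheaf X"
  shows "is_interpretation (G_obj (W_obj X)) (G_obj X) inst_judgement"
proof -
  have "is_ty (snd (inst_judgement J)) = is_ty (snd J)" "is_tm (snd (inst_judgement J)) = is_tm (snd J)"
    for J :: "(nat \<times> (nat \<times> 'a, nat \<times> 'b) judgement set, nat \<times> (nat \<times> 'a, nat \<times> 'b) judgement set) judgement"
    by (cases J; cases "snd J"; simp)+
  moreover have "inst_judgement J = K"
    if "set Js \<subseteq> derived (G_obj (W_obj X))" "step r Js J" "step r (map inst_judgement Js) K" for r Js J K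
    using step_inst_judgement[OF X that(1,2)] that(3) by (rule step_unique)
  ultimately show ?thesis
    unfolding is_interpretation_def
    by (intro conjI ballI allI impI) (simp_all only: derived_inst_judgement[OF X] boundary_inst_judgement)
qed

section \<open>The counit\<close>

lemma interpretation_derived:
  "is_interpretation T U \<phi> \<Longrightarrow> J \<in> derived T \<Longrightarrow> \<phi> J \<in> derived U"
  and interpretation_boundary:
  "is_interpretation T U \<phi> \<Longrightarrow> J \<in> derived T \<Longrightarrow> boundary (\<phi> J) = map \<phi> (boundary J)"
  and interpretation_is_ty:
  "is_interpretation T U \<phi> \<Longrightarrow> J \<in> derived T \<Longrightarrow> is_ty (snd (\<phi> J)) = is_ty (snd J)"
  and interpretation_is_tm:
  "is_interpretation T U \<phi> \<Longrightarrow> J \<in> derived T \<Longrightarrow> is_tm (snd (\<phi> J)) = is_tm (snd J)"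
  and interpretation_step:
  "is_interpretation T U \<phi> \<Longrightarrow> set Js \<subseteq> derived T \<Longrightarrow> step r Js J \<Longrightarrow> step r (map \<phi> Js) K \<Longrightarrow> \<phi> J = K"
  unfolding is_interpretation_def by blast+

text \<open>A renaming is applicable to every judgement, so preservation of this rule has no side condition.\<close>

lemma interpretation_permute:
  assumes "is_interpretation T U \<phi>" "J \<in> derived T" "bij \<sigma>"
  shows "\<phi> (permute \<sigma> J) = permute \<sigma> (\<phi> J)"
  using assms(2,3)
  by (intro interpretation_step[OF assms(1) _ step.intros(9)[OF assms(3), of J]])
     (simp_all add: step.intros(9))

text \<open>Suppose that \<open>v\<close> occurs in \<open>\<phi>(J)\<close> but not in \<open>J\<close>, and exchange \<open>v\<close> with a variable \<open>w\<close> that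
  occurs in neither. This fixes \<open>J\<close>, hence \<open>\<phi>(J)\<close> by equivariance, and brings \<open>w\<close> into \<open>\<phi>(J)\<close>.\<close>

lemma interpretation_vars:
  assumes X: "is_presheaf X" and \<phi>: "is_interpretation (G_obj X) U \<phi>" and J: "J \<in> derived (G_obj X)"
  shows "fst ` set (fst (\<phi> J)) \<subseteq> fst ` set (fst J)"
proof
  fix v assume v: "v \<in> fst ` set (fst (\<phi> J))"
  show "v \<in> fst ` set (fst J)"
  proof (rule ccontr)
    assume v': "v \<notin> fst ` set (fst J)"
    obtain w where w: "w \<notin> fst ` set (fst (\<phi> J)) \<union> fst ` set (fst J)"
      using ex_new_if_finite[OF infinite_UNIV_nat, of "fst ` set (fst (\<phi> J)) \<union> fst ` set (fst J)"] by auto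
    let ?\<sigma> = "transpose v w"
    obtain \<Gamma> R where [simp]: "J = (\<Gamma>, R)" by (cases J)
    have "ctx_fv \<Gamma> \<union> rhs_fv R \<subseteq> fst ` set \<Gamma>"
      using ctx_fv_derived_free[OF X, of \<Gamma> R] derived_free_shape[OF X, of \<Gamma> R] J by simp
    then have "permute ?\<sigma> (\<Gamma>, R) = permute id (\<Gamma>, R)"
      using v' w by (intro permute_cong) (auto simp: transpose_def)
    then have "permute ?\<sigma> J = J" unfolding permute_id by simp
    then have "\<phi> J = permute ?\<sigma> (\<phi> J)"
      using interpretation_permute[OF \<phi> J, of ?\<sigma>] by simp
    then have "fst ` set (fst (\<phi> J)) = ?\<sigma> ` fst ` set (fst (\<phi> J))"
      using vars_permute[of ?\<sigma> "\<phi> J"] by (simp only:)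
    moreover have "w \<in> ?\<sigma> ` fst ` set (fst (\<phi> J))"
      using v by (intro image_eqI[of _ _ v]) simp_all
    ultimately show False using w by simp
  qed
qed

text \<open>All interpretations in a class, at all representatives of \<open>[J]\<close>, take values in the same class: equivalent
  interpretations have equivalent values, and equivalent judgements differ by a renaming.\<close>

lemma V_mor_interpretation:
  assumes X: "is_presheaf X" and Y: "is_presheaf Y" and \<phi>: "is_interpretation (G_obj Y) (G_obj X) \<phi>"
    and J: "J \<in> derived (G_obj Y)" "is_ty (snd J) \<or> is_tm (snd J)"
  shows "V_mor (G_obj X) (interp_equiv (G_obj Y) (G_obj X) `` {\<phi>}) (equiv_judgements (G_obj Y) `` {J}) =
    equiv_judgements (G_obj X) `` {\<phi> J}"
proof -
  let ?E = "equiv_judgements (G_obj X)"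
  have refl: "(\<phi> K, \<phi> K) \<in> ?E" if "K \<in> derived (G_obj Y)" "is_ty (snd K) \<or> is_tm (snd K)" for K
    using that interpretation_derived[OF \<phi>] interpretation_is_ty[OF \<phi>] interpretation_is_tm[OF \<phi>]
    by (intro equiv_free_refl[OF X]) simp_all
  have same: "?E `` {\<psi> K} = ?E `` {\<phi> J}"
    if \<psi>: "(\<phi>, \<psi>) \<in> interp_equiv (G_obj Y) (G_obj X)" and K: "(J, K) \<in> equiv_judgements (G_obj Y)" for \<psi> K
  proof -
    from \<psi> have int: "is_interpretation (G_obj Y) (G_obj X) \<psi>"
      and all: "\<forall>J\<in>derived (G_obj Y). is_ty (snd J) \<or> is_tm (snd J) \<longrightarrow> (\<phi> J, \<psi> J) \<in> ?E"
      unfolding interp_equiv_def by blast+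
    from bspec[OF all J(1)] J(2) have eq: "(\<phi> J, \<psi> J) \<in> ?E" by (rule mp)
    from K obtain \<sigma> where \<sigma>: "bij \<sigma>" "K = permute \<sigma> J" unfolding equiv_free[OF Y] by (elim conjE exE)
    have "(\<psi> J, \<psi> K) \<in> ?E"
      using interpretation_permute[OF int J(1) \<sigma>(1)] \<sigma> J interpretation_derived[OF int J(1)]
        interpretation_is_ty[OF int J(1)] interpretation_is_tm[OF int J(1)]
      unfolding equiv_free[OF X] by (intro conjI exI[of _ \<sigma>]) simp_all
    then show ?thesis using equiv_free_class_eq[OF X eq] equiv_free_class_eq[OF X, of "\<psi> J"] by simp
  qed
  have \<phi>_mem: "\<phi> \<in> interp_equiv (G_obj Y) (G_obj X) `` {\<phi>}"
    using \<phi> refl by (simp add: interp_equiv_def)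
  have J_mem: "J \<in> equiv_judgements (G_obj Y) `` {J}" using equiv_free_refl[OF Y J] by simp
  show ?thesis
    unfolding V_mor_def
  proof (intro equalityI UN_least subsetI)
    fix \<psi> K L
    assume "\<psi> \<in> interp_equiv (G_obj Y) (G_obj X) `` {\<phi>}" "K \<in> equiv_judgements (G_obj Y) `` {J}"
      "L \<in> ?E `` {\<psi> K}"
    then show "L \<in> ?E `` {\<phi> J}" using same[of \<psi> K] by simp
  qed (intro UN_I[OF \<phi>_mem] UN_I[OF J_mem])
qed

text \<open>The substitution shows that the right-hand sides of the equations \<open>\<phi>(r(J\<^sub>1, \<dots>)) = r(\<phi>(J\<^sub>1), \<dots>)\<close> are
  defined, so these equations determine \<open>\<phi>\<close> from its values on basic judgements. There \<open>\<phi>\<close> and the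
  substitution both pick a member of \<open>C\<close>, and members with the same variables are equal. The variables
  agree: those before the last by induction, since boundaries are preserved, and the last because no
  other variable of the basic judgement is left.\<close>

lemma interpretation_eq_inst:
  assumes X: "is_presheaf X" and \<phi>: "is_interpretation (G_obj (W_obj X)) (G_obj X) \<phi>"
    and ty: "\<And>n C. n \<ge> 1 \<Longrightarrow> C \<in> Ty (W_obj X) n \<Longrightarrow> \<phi> (free_ty (W_obj X) n C) \<in> C"
    and tm: "\<And>n C. n \<ge> 1 \<Longrightarrow> C \<in> Tm (W_obj X) n \<Longrightarrow> \<phi> (free_tm (W_obj X) n C) \<in> C"
    and "J \<in> derived (G_obj (W_obj X))"
  shows "\<phi> J = inst_judgement J"
  using assms(5)
proof (induction rule: derived.induct)
  case (rule r Js J)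
  have Js: "set Js \<subseteq> derived (G_obj (W_obj X))" using rule.IH by auto
  have "map \<phi> Js = map inst_judgement Js" using rule.IH by simp
  then have "step r (map \<phi> Js) (inst_judgement J)"
    using step_inst_judgement[OF X Js rule.hyps] by (simp only:)
  then show ?case by (rule interpretation_step[OF \<phi> Js rule.hyps])
next
  case (basic J)
  note W = is_presheaf_W[OF X]
  from basic.hyps consider (ty) n C where "J = free_ty (W_obj X) n C" "n \<ge> 1" "C \<in> Ty (W_obj X) n"
    | (tm) n C where "J = free_tm (W_obj X) n C" "n \<ge> 1" "C \<in> Tm (W_obj X) n"
    unfolding Basic_G_obj by blast
  then show ?case
  proof cases
    case ty
    let ?J = "free_ty (W_obj X) n C"
    have mem: "\<phi> ?J \<in> C" using assms(3) ty by simp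
    have J: "?J \<in> derived (G_obj (W_obj X))" using derived_free_ty[OF W ty(2,3)] .
    obtain \<Gamma> S where \<Gamma>: "\<phi> ?J = (\<Gamma>, IsTy S)"
      using W_ty_D(2)[OF X ty(3) mem] by (cases "\<phi> ?J"; cases "snd (\<phi> ?J)") auto
    have der: "(\<Gamma>, IsTy S) \<in> derived (G_obj X)" and len: "Suc (length \<Gamma>) = n"
      using W_ty_D(1,3)[OF X ty(3) mem] by (simp_all add: \<Gamma> degree_def)
    have "map fst \<Gamma> = [1..<n]"
    proof (cases "n = 1")
      case True
      then show ?thesis using len by simp
    next
      case False
      then obtain m where m: "n = Suc m" "m \<ge> 1" using ty(2) by (cases n) auto
      let ?K = "free_ty (W_obj X) m (bdTy (W_obj X) m C)"
      have bd: "boundary ?J = [?K]" using boundary_free_ty[OF m(2)] m(1) by simp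
      have "\<Gamma> \<noteq> []" using len m by auto
      then obtain \<Gamma>' y S' where \<Gamma>': "\<Gamma> = \<Gamma>' @ [(y, S')]" by (metis rev_exhaust surj_pair)
      have "boundary (\<phi> ?J) = [inst_judgement ?K]"
        using interpretation_boundary[OF \<phi> J] basic.IH bd ty(1) by simp
      then have "inst_judgement ?K = (\<Gamma>', IsTy S')" by (simp add: \<Gamma> \<Gamma>')
      then have vars: "map fst \<Gamma>' = [1..<m]"
        using map_fst_inst_judgement[of ?K] by (simp add: free_ty_def)
      have "y \<in> fst ` set (fst (\<phi> ?J))" by (simp add: \<Gamma> \<Gamma>')
      \<comment> \<open>The last variable is \<open>m\<close>: it lies in \<open>[1, m]\<close> and differs from \<open>1, \<dots>, m - 1\<close>.\<close>
      then have "y \<in> fst ` set (fst ?J)" using interpretation_vars[OF W \<phi> J] by (rule subsetD[rotated])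
      then have "y \<in> {1..<n}" unfolding free_ty_def fst_conv fst_free_ctx .
      moreover have "y \<notin> set (map fst \<Gamma>')"
        using derived_free_shape[OF X der] by (simp add: \<Gamma>')
      ultimately have "y = m" using vars m by auto
      then show ?thesis using vars m by (simp add: \<Gamma>')
    qed
    then show ?thesis using inst_free_ty[OF X ty(2,3), of \<Gamma> S] mem ty(1) \<Gamma> by simp
  next
    case tm
    let ?J = "free_tm (W_obj X) n C" and ?K = "free_ty (W_obj X) n (bdTm (W_obj X) n C)"
    have mem: "\<phi> ?J \<in> C" using assms(4) tm by simp
    have J: "?J \<in> derived (G_obj (W_obj X))" using derived_free_tm[OF W tm(2,3)] .
    obtain \<Gamma> s S where \<Gamma>: "\<phi> ?J = (\<Gamma>, HasTm s S)"
      using W_tm_D(2)[OF X tm(3) mem] by (cases "\<phi> ?J"; cases "snd (\<phi> ?J)") auto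
    have "boundary (\<phi> ?J) = [inst_judgement ?K]"
      using interpretation_boundary[OF \<phi> J] basic.IH boundary_free_tm[of "W_obj X" n C] tm(1) by simp
    then have "inst_judgement ?K = (\<Gamma>, IsTy S)" by (simp add: \<Gamma>)
    then have "map fst \<Gamma> = [1..<n]"
      using map_fst_inst_judgement[of ?K] by (simp add: free_ty_def)
    then show ?thesis using inst_free_tm[OF X tm(2,3), of \<Gamma> s S] mem tm(1) \<Gamma> by simp
  qed
qed

lemma counit_G_obj:
  assumes X: "is_presheaf X"
  shows "counit (G_obj X) = interp_equiv (G_obj (W_obj X)) (G_obj X) `` {inst_judgement}"
    (is "_ = ?m")
  unfolding counit_def
proof (rule the_equality)
  note W = is_presheaf_W[OF X]
  note int = is_interpretation_inst[OF X]
  have "?m \<in> gat_hom (G_obj (W_obj X)) (G_obj X)"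
    using is_gat_G_obj[OF X] is_gat_G_obj[OF W] int by (simp add: gat_hom_def quotientI)
  moreover have "V_mor (G_obj X) ?m (unit_ty (W_obj X) n C) = C"
    if n: "n \<ge> 1" and C: "C \<in> Ty (W_obj X) n" for n C
  proof -
    obtain \<Gamma> S where J: "(\<Gamma>, IsTy S) \<in> C" "map fst \<Gamma> = [1..<n]"
      using W_ty_standard[OF X C] by (elim exE conjE)
    show ?thesis
      using V_mor_interpretation[OF X W int derived_free_ty[OF W n C]]
        inst_free_ty[OF X n C J] W_ty_D(4)[OF X C J(1)]
      by (simp add: unit_ty_def free_ty_def)
  qed
  moreover have "V_mor (G_obj X) ?m (unit_tm (W_obj X) n C) = C"
    if n: "n \<ge> 1" and C: "C \<in> Tm (W_obj X) n" for n C
  proof -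
    obtain \<Gamma> s S where J: "(\<Gamma>, HasTm s S) \<in> C" "map fst \<Gamma> = [1..<n]"
      using W_tm_standard[OF X C] by (elim exE conjE)
    show ?thesis
      using V_mor_interpretation[OF X W int derived_free_tm[OF W n C]]
        inst_free_tm[OF X n C J] W_tm_D(4)[OF X C J(1)]
      by (simp add: unit_tm_def free_tm_def del: inst.simps)
  qed
  ultimately show "?m \<in> gat_hom (G_obj (W_obj X)) (G_obj X) \<and>
     (\<forall>n\<ge>1. (\<forall>c\<in>Ty (W_obj X) n. V_mor (G_obj X) ?m (unit_ty (W_obj X) n c) = c) \<and>
             (\<forall>c\<in>Tm (W_obj X) n. V_mor (G_obj X) ?m (unit_tm (W_obj X) n c) = c))" by simp
next
  note W = is_presheaf_W[OF X]
  fix m assume m: "m \<in> gat_hom (G_obj (W_obj X)) (G_obj X) \<and>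
     (\<forall>n\<ge>1. (\<forall>c\<in>Ty (W_obj X) n. V_mor (G_obj X) m (unit_ty (W_obj X) n c) = c) \<and>
             (\<forall>c\<in>Tm (W_obj X) n. V_mor (G_obj X) m (unit_tm (W_obj X) n c) = c))"
  then have "m \<in> Collect (is_interpretation (G_obj (W_obj X)) (G_obj X)) //
      interp_equiv (G_obj (W_obj X)) (G_obj X)"
    by (simp add: gat_hom_def split: if_splits)
  then obtain \<phi> where \<phi>: "is_interpretation (G_obj (W_obj X)) (G_obj X) \<phi>"
    and m_eq: "m = interp_equiv (G_obj (W_obj X)) (G_obj X) `` {\<phi>}"
    by (elim quotientE) simp
  have refl: "(\<phi> J, \<phi> J) \<in> equiv_judgements (G_obj X)"
    if "J \<in> derived (G_obj (W_obj X))" "is_ty (snd J) \<or> is_tm (snd J)" for J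
    using that interpretation_derived[OF \<phi>] interpretation_is_ty[OF \<phi>] interpretation_is_tm[OF \<phi>]
    by (intro equiv_free_refl[OF X]) simp_all
  have ty: "\<phi> (free_ty (W_obj X) n C) \<in> C" if n: "n \<ge> 1" and C: "C \<in> Ty (W_obj X) n" for n C
  proof -
    have "V_mor (G_obj X) m (unit_ty (W_obj X) n C) = C" using m n C by simp
    then show ?thesis
      using V_mor_interpretation[OF X W \<phi> derived_free_ty[OF W n C]] refl[OF derived_free_ty[OF W n C]]
      by (simp add: unit_ty_def m_eq free_ty_def) blast
  qed
  have tm: "\<phi> (free_tm (W_obj X) n C) \<in> C" if n: "n \<ge> 1" and C: "C \<in> Tm (W_obj X) n" for n C
  proof -
    have "V_mor (G_obj X) m (unit_tm (W_obj X) n C) = C" using m n C by simp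
    then show ?thesis
      using V_mor_interpretation[OF X W \<phi> derived_free_tm[OF W n C]] refl[OF derived_free_tm[OF W n C]]
      by (simp add: unit_tm_def m_eq free_tm_def) blast
  qed
  have "\<phi> J = inst_judgement J" if "J \<in> derived (G_obj (W_obj X))" for J
    using interpretation_eq_inst[OF X \<phi> ty tm that] .
  then show "m = ?m"
    using \<phi> is_interpretation_inst[OF X] by (auto simp: m_eq interp_equiv_def)
qed

lemma W_mult_class:
  assumes X: "is_presheaf X"
    and J: "J \<in> derived (G_obj (W_obj X))" "is_ty (snd J) \<or> is_tm (snd J)"
  shows "W_mult X (equiv_judgements (G_obj (W_obj X)) `` {J}) =
    equiv_judgements (G_obj X) `` {inst_judgement J}"
  unfolding W_mult_def counit_G_obj[OF X]
  by (rule V_mor_interpretation[OF X is_presheaf_W[OF X] is_interpretation_inst[OF X] J])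

section \<open>Heaps\<close>

lemma Hp_0: "\<phi> \<in> Hp n \<Longrightarrow> \<phi> 0 = 0"
  and Hp_less: "\<phi> \<in> Hp n \<Longrightarrow> i \<in> {1..n} \<Longrightarrow> \<phi> i < i"
  by (simp_all add: Hp_def)

lemma Hp_funpow_0: "\<phi> \<in> Hp n \<Longrightarrow> (\<phi> ^^ k) 0 = 0"
  by (induction k) (simp_all add: Hp_0)

lemma Hp_funpow_le:
  assumes \<phi>: "\<phi> \<in> Hp n" and i: "i \<le> n"
  shows "(\<phi> ^^ k) i \<le> i - k"
proof (induction k)
  case (Suc k)
  show ?case
  proof (cases "(\<phi> ^^ k) i = 0")
    case True
    then show ?thesis using Hp_0[OF \<phi>] by simp
  next
    case False
    then have "\<phi> ((\<phi> ^^ k) i) < (\<phi> ^^ k) i" using Suc i by (intro Hp_less[OF \<phi>]) auto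
    then show ?thesis using Suc by simp
  qed
qed simp

text \<open>The depth counts the distinct proper ancestors, among them \<open>0\<close>. Passing to the parent loses exactly
  the parent itself, because all later ancestors are smaller, unless the parent is \<open>0\<close>, which is its
  own ancestor.\<close>

lemma dp_rec:
  assumes \<phi>: "\<phi> \<in> Hp n" and i: "i \<in> {1..n}"
  shows "dp \<phi> i = (if \<phi> i = 0 then 1 else Suc (dp \<phi> (\<phi> i)))"
proof -
  let ?S = "\<lambda>i. {(\<phi> ^^ k) i |k. k \<ge> 1}"
  have less: "\<phi> i < i" by (rule Hp_less[OF \<phi> i])
  have le: "(\<phi> ^^ k) (\<phi> i) \<le> \<phi> i - k" for k
    using less i by (intro Hp_funpow_le[OF \<phi>]) simp
  have S: "?S i = insert (\<phi> i) (?S (\<phi> i))"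
  proof (intro equalityI subsetI)
    fix j assume "j \<in> ?S i"
    then obtain k where k: "k \<ge> 1" "j = (\<phi> ^^ k) i" by auto
    then obtain l where "k = Suc l" by (cases k) auto
    with k(2) have "j = (\<phi> ^^ l) (\<phi> i)" by (simp add: funpow_swap1)
    then show "j \<in> insert (\<phi> i) (?S (\<phi> i))" by (cases "l \<ge> 1") (auto simp: not_le)
  next
    fix j assume "j \<in> insert (\<phi> i) (?S (\<phi> i))"
    then have "\<exists>k. j = (\<phi> ^^ k) (\<phi> i)"
    proof
      assume "j = \<phi> i"
      then show ?thesis by (intro exI[of _ 0]) simp
    qed auto
    then obtain k where "j = (\<phi> ^^ Suc k) i" by (auto simp: funpow_swap1)
    moreover have "Suc k \<ge> 1" by simp
    ultimately show "j \<in> ?S i" by (intro CollectI exI conjI)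
  qed
  show ?thesis
  proof (cases "\<phi> i = 0")
    case True
    then have "?S (\<phi> i) = {0}" using Hp_funpow_0[OF \<phi>] by auto
    then show ?thesis using S True by (simp add: dp_def)
  next
    case False
    have "?S (\<phi> i) \<subseteq> {..<\<phi> i}"
    proof
      fix j assume "j \<in> ?S (\<phi> i)"
      then obtain k where "k \<ge> 1" "j = (\<phi> ^^ k) (\<phi> i)" by auto
      then show "j \<in> {..<\<phi> i}" using le[of k] False by simp
    qed
    then have "finite (?S (\<phi> i))" "\<phi> i \<notin> ?S (\<phi> i)" by (auto intro: finite_subset)
    then show ?thesis using False unfolding dp_def S by simp
  qed
qed

lemma dp_pos: "\<phi> \<in> Hp n \<Longrightarrow> i \<in> {1..n} \<Longrightarrow> dp \<phi> i \<ge> 1"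
  by (simp add: dp_rec)

lemma dp_funpow:
  assumes \<phi>: "\<phi> \<in> Hp n" and i: "i \<in> {1..n}"
  shows "k < dp \<phi> i \<Longrightarrow> (\<phi> ^^ k) i \<in> {1..n} \<and> dp \<phi> ((\<phi> ^^ k) i) = dp \<phi> i - k"
proof (induction k)
  case 0
  then show ?case using i by simp
next
  case (Suc k)
  let ?v = "(\<phi> ^^ k) i"
  have v: "?v \<in> {1..n}" "dp \<phi> ?v = dp \<phi> i - k" using Suc by simp_all
  then have "\<phi> ?v \<noteq> 0" "dp \<phi> ?v = Suc (dp \<phi> (\<phi> ?v))"
    using dp_rec[OF \<phi> v(1)] Suc.prems by (simp_all split: if_splits)
  then show ?case using v Hp_less[OF \<phi> v(1)] by simp
qed

lemma funpow_dp:
  assumes \<phi>: "\<phi> \<in> Hp n" and i: "i \<in> {1..n}" and k: "k \<ge> dp \<phi> i"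
  shows "(\<phi> ^^ k) i = 0"
proof -
  obtain d where d: "dp \<phi> i = Suc d" using dp_pos[OF \<phi> i] by (cases "dp \<phi> i") auto
  let ?v = "(\<phi> ^^ d) i"
  have v: "?v \<in> {1..n}" "dp \<phi> ?v = 1" using dp_funpow[OF \<phi> i, of d] d by simp_all
  then have "\<phi> ?v = 0"
  proof -
    have "\<phi> ?v \<in> {1..n}" if "\<phi> ?v \<noteq> 0" using that Hp_less[OF \<phi> v(1)] v(1) by simp
    then show ?thesis using dp_rec[OF \<phi> v(1)] v(2) dp_pos[OF \<phi>, of "\<phi> ?v"] by (cases "\<phi> ?v = 0") auto
  qed
  then have "(\<phi> ^^ Suc d) i = 0" by simp
  moreover have "(\<phi> ^^ k) i = (\<phi> ^^ (k - Suc d)) ((\<phi> ^^ Suc d) i)"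
    using k d by (simp add: funpow_add[THEN fun_cong, unfolded o_apply, symmetric] del: funpow.simps)
  ultimately show ?thesis using Hp_funpow_0[OF \<phi>] by simp
qed

lemma dp_eqI:
  assumes \<phi>: "\<phi> \<in> Hp n" and i: "i \<in> {1..n}"
    and "\<And>k. k < d \<Longrightarrow> (\<phi> ^^ k) i \<noteq> 0" "(\<phi> ^^ d) i = 0"
  shows "dp \<phi> i = d"
proof (rule antisym)
  show "dp \<phi> i \<le> d" using dp_funpow[OF \<phi> i, of d] assms(4) by (cases "d < dp \<phi> i") auto
  show "d \<le> dp \<phi> i" using funpow_dp[OF \<phi> i, of "dp \<phi> i"] assms(3)[of "dp \<phi> i"] by (cases "dp \<phi> i < d") auto
qed

lemma funpow_restrict:
  assumes \<phi>: "\<phi> \<in> Hp n" and m: "m \<le> n" and i: "i \<le> m"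
  shows "(restrict \<phi> {0..m} ^^ k) i = (\<phi> ^^ k) i"
proof (induction k)
  case (Suc k)
  moreover have "(\<phi> ^^ k) i \<le> m" using Hp_funpow_le[OF \<phi>, of i k] m i by simp
  ultimately show ?case by simp
qed simp

lemma dp_restrict:
  "\<phi> \<in> Hp n \<Longrightarrow> m \<le> n \<Longrightarrow> i \<le> m \<Longrightarrow> dp (restrict \<phi> {0..m}) i = dp \<phi> i"
  by (simp add: dp_def funpow_restrict)

text \<open>Every node \<open>i\<close> has the single degree \<open>dp \<phi> i\<close>, so the indexing by degrees disappears.\<close>

lemma heap_maps_iff:
  assumes \<phi>: "\<phi> \<in> Hp n"
  shows "h \<in> heap_maps X n \<phi> \<longleftrightarrow> h \<in> extensional {1..n} \<and>
    (\<forall>i\<in>{1..n}. h i \<in> Ty X (dp \<phi> i) \<and> (\<phi> i \<noteq> 0 \<longrightarrow> h (\<phi> i) = bdTy X (dp \<phi> (\<phi> i)) (h i)))"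
    (is "?L \<longleftrightarrow> _ \<and> (\<forall>i\<in>_. ?P i)")
proof
  assume ?L
  then have nat: "nat_trans (heap_presheaf n \<phi>) X (\<lambda>m. h) (\<lambda>m _. undefined)"
    and ext: "h \<in> extensional {1..n}" by (simp_all add: heap_maps_def)
  have "?P i" if i: "i \<in> {1..n}" for i
  proof -
    have "h i \<in> Ty X (dp \<phi> i)"
      using nat dp_pos[OF \<phi> i] i by (auto simp: nat_trans_def heap_presheaf_def)
    moreover have "h (\<phi> i) = bdTy X (dp \<phi> (\<phi> i)) (h i)" if "\<phi> i \<noteq> 0"
    proof -
      have "\<phi> i \<in> {1..n}" using that Hp_less[OF \<phi> i] i by simp
      then have "dp \<phi> (\<phi> i) \<ge> 1" by (rule dp_pos[OF \<phi>])
      moreover have "dp \<phi> i = Suc (dp \<phi> (\<phi> i))" using dp_rec[OF \<phi> i] that by simp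
      ultimately show ?thesis using nat i by (simp add: nat_trans_def heap_presheaf_def)
    qed
    ultimately show ?thesis by simp
  qed
  with ext show "h \<in> extensional {1..n} \<and> (\<forall>i\<in>{1..n}. ?P i)" by simp
next
  assume R: "h \<in> extensional {1..n} \<and> (\<forall>i\<in>{1..n}. ?P i)"
  have "h (\<phi> i) = bdTy X m (h i)" if "m \<ge> 1" "i \<in> {1..n}" "dp \<phi> i = Suc m" for m i
    using dp_rec[OF \<phi> that(2)] that R by (auto split: if_splits)
  then have "nat_trans (heap_presheaf n \<phi>) X (\<lambda>m. h) (\<lambda>m _. undefined)"
    using R by (auto simp: nat_trans_def heap_presheaf_def)
  then show ?L using R by (simp add: heap_maps_def)
qed

section \<open>The judgement of a heap is derivable\<close>

lemma map_fst_heap_ctx [simp]: "map fst (heap_ctx n \<phi> h) = [1..<n]"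
  by (simp add: heap_ctx_def comp_def)

lemma heap_args_Var: "heap_args \<phi> i = map Var (map (\<lambda>l. (\<phi> ^^ (dp \<phi> i - l)) i) [1..<dp \<phi> i])"
  by (simp add: heap_args_def)

lemma heap_args_eqI:
  assumes "map \<sigma> [1..<dp \<phi> i] = map (\<lambda>l. (\<phi> ^^ (dp \<phi> i - l)) i) [1..<dp \<phi> i]"
  shows "map (\<lambda>l. Var (\<sigma> l)) [Suc 0..<dp \<phi> i] = heap_args \<phi> i"
  unfolding heap_args_Var assms[symmetric] by simp

lemma fv_heap_expr: "fv (heap_expr \<phi> h i) = (\<lambda>l. (\<phi> ^^ (dp \<phi> i - l)) i) ` {1..<dp \<phi> i}"
  by (auto simp: heap_expr_def heap_args_def)

lemma bd_iter_heap:
  assumes \<phi>: "\<phi> \<in> Hp n" and h: "h \<in> heap_maps X n \<phi>" and i: "i \<in> {1..n}"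
  shows "k < dp \<phi> i \<Longrightarrow> bd_iter X (dp \<phi> i - k) k (h i) = h ((\<phi> ^^ k) i)"
proof (induction k)
  case (Suc k)
  let ?v = "(\<phi> ^^ k) i"
  have v: "?v \<in> {1..n}" "dp \<phi> ?v = dp \<phi> i - k" using dp_funpow[OF \<phi> i, of k] Suc.prems by simp_all
  have Sv: "\<phi> ?v \<noteq> 0" "dp \<phi> (\<phi> ?v) = dp \<phi> i - Suc k"
    using dp_funpow[OF \<phi> i Suc.prems] by simp_all
  have "Suc (dp \<phi> i - Suc k) = dp \<phi> i - k" using Suc.prems by simp
  then have "bd_iter X (dp \<phi> i - Suc k) (Suc k) (h i) = bdTy X (dp \<phi> i - Suc k) (h ?v)"
    using Suc by simp
  also have "\<dots> = h (\<phi> ?v)"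
    using h v(1) Sv unfolding heap_maps_iff[OF \<phi>] by (metis (no_types, lifting))
  finally show ?case by simp
qed simp

text \<open>Interpolates between the context of the ancestors of \<open>i\<close>, in which \<open>h i\<close> is introduced (\<open>m = 1\<close>), and
  the full context \<open>heap_ctx i \<phi> h\<close> (\<open>m = i\<close>): to the ancestors are added the nodes below \<open>m\<close>.\<close>

definition ancestors_ctx ::
  "(nat \<Rightarrow> nat) \<Rightarrow> (nat \<Rightarrow> 'a) \<Rightarrow> nat \<Rightarrow> nat \<Rightarrow> (nat \<times> 'a, nat \<times> 'b) ctx" where
  "ancestors_ctx \<phi> h i m =
     map (\<lambda>j. (j, heap_expr \<phi> h j)) (filter (\<lambda>j. j < m \<or> (\<exists>k\<ge>1. j = (\<phi> ^^ k) i)) [1..<i])"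

text \<open>Both lists are strictly increasing with the same elements.\<close>

lemma ancestors_list:
  assumes \<phi>: "\<phi> \<in> Hp n" and i: "i \<in> {1..n}"
  shows "filter (\<lambda>j. j < 1 \<or> (\<exists>k\<ge>1. j = (\<phi> ^^ k) i)) [1..<i] =
    map (\<lambda>l. (\<phi> ^^ (dp \<phi> i - l)) i) [1..<dp \<phi> i]"
proof (rule strict_sorted_equal)
  let ?d = "dp \<phi> i"
  let ?f = "\<lambda>l. (\<phi> ^^ (?d - l)) i"
  show "sorted_wrt (<) (filter (\<lambda>j. j < 1 \<or> (\<exists>k\<ge>1. j = (\<phi> ^^ k) i)) [1..<i])"
    by (rule sorted_wrt_filter) simp
  have "?f l < ?f l'" if "l < l'" "l' < ?d" for l l'
  proof -
    have v: "?f l' \<in> {1..n}" using dp_funpow[OF \<phi> i, of "?d - l'"] that by simp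
    have "?d - l = (l' - l) + (?d - l')" using that by simp
    then have "?f l = (\<phi> ^^ (l' - l)) (?f l')" by (simp only: funpow_add o_apply)
    also have "\<dots> \<le> ?f l' - (l' - l)" using v by (intro Hp_funpow_le[OF \<phi>]) simp
    also have "\<dots> < ?f l'" using v that by (intro diff_less) auto
    finally show ?thesis .
  qed
  then show "sorted_wrt (<) (map ?f [1..<?d])"
    unfolding sorted_wrt_map by (intro sorted_wrt_mono_rel[OF _ sorted_wrt_upt]) simp
  show "set (filter (\<lambda>j. j < 1 \<or> (\<exists>k\<ge>1. j = (\<phi> ^^ k) i)) [1..<i]) = set (map ?f [1..<?d])"
  proof (intro equalityI subsetI)
    fix j assume "j \<in> set (filter (\<lambda>j. j < 1 \<or> (\<exists>k\<ge>1. j = (\<phi> ^^ k) i)) [1..<i])"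
    then obtain k where k: "k \<ge> 1" "j = (\<phi> ^^ k) i" "j \<ge> 1" by auto
    then have "k < ?d" using funpow_dp[OF \<phi> i, of k] by (cases "k < ?d") auto
    then show "j \<in> set (map ?f [1..<?d])" using k by (auto intro!: image_eqI[of _ _ "?d - k"])
  next
    fix j assume "j \<in> set (map ?f [1..<?d])"
    then obtain l where l: "j = ?f l" "l \<in> {1..<?d}" by auto
    have "j \<in> {1..n}" using dp_funpow[OF \<phi> i, of "?d - l"] l by simp
    moreover have "i - (?d - l) < i" using l i by (intro diff_less) auto
    then have "j < i" using Hp_funpow_le[OF \<phi>, of i "?d - l"] l(1) i
      by (intro le_less_trans[OF _ \<open>i - (?d - l) < i\<close>]) simp
    moreover have "\<exists>k\<ge>1. j = (\<phi> ^^ k) i" using l by (intro exI[of _ "?d - l"]) auto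
    ultimately show "j \<in> set (filter (\<lambda>j. j < 1 \<or> (\<exists>k\<ge>1. j = (\<phi> ^^ k) i)) [1..<i])" by simp
  qed
qed

text \<open>The renaming sends \<open>l\<close> to the ancestor of \<open>i\<close> of depth \<open>l\<close>. The ancestors of that one are ancestors of
  \<open>i\<close>, and its label is an iterated boundary of \<open>h i\<close> because \<open>h\<close> is natural.\<close>

lemma ex_permute_free_ctx:
  fixes X :: "('a, 'b) presheaf"
  assumes \<phi>: "\<phi> \<in> Hp n" and h: "h \<in> heap_maps X n \<phi>" and i: "i \<in> {1..n}"
  shows "\<exists>\<sigma>. bij \<sigma> \<and> map \<sigma> [1..<dp \<phi> i] = map (\<lambda>l. (\<phi> ^^ (dp \<phi> i - l)) i) [1..<dp \<phi> i] \<and>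
    map (map_prod \<sigma> (map_expr \<sigma> id)) (free_ctx X (dp \<phi> i) (h i)) = ancestors_ctx \<phi> h i 1"
proof -
  let ?d = "dp \<phi> i"
  let ?f = "\<lambda>l. (\<phi> ^^ (?d - l)) i"
  have "distinct (map ?f [1..<?d])" unfolding ancestors_list[OF \<phi> i, symmetric] by simp
  then obtain \<sigma> where \<sigma>: "bij \<sigma>" "map \<sigma> [1..<?d] = map ?f [1..<?d]"
    using ex_bij_map_eq[of "[1..<?d]" "map ?f [1..<?d]"] by auto
  have \<sigma>f: "\<sigma> l = ?f l" if "l \<in> {1..<?d}" for l
    using \<sigma>(2) that unfolding map_eq_conv by simp
  have "map_expr \<sigma> id (free_expr_ty l (bd_iter X l (?d - l) (h i))) =
      (heap_expr \<phi> h (?f l) :: (nat \<times> 'a, nat \<times> 'b) exp)"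
    if l: "l \<in> {1..<?d}" for l
  proof -
    have dl: "dp \<phi> (?f l) = l" using dp_funpow[OF \<phi> i, of "?d - l"] l by simp
    have hl: "bd_iter X l (?d - l) (h i) = h (?f l)"
      using bd_iter_heap[OF \<phi> h i, of "?d - l"] l by simp
    have "\<sigma> m = (\<phi> ^^ (l - m)) (?f l)" if "m \<in> {1..<l}" for m
    proof -
      have "?d - m = (l - m) + (?d - l)" using that l by simp
      then have "?f m = (\<phi> ^^ (l - m)) (?f l)" by (simp only: funpow_add o_apply)
      then show ?thesis using \<sigma>f[of m] that l by simp
    qed
    then show ?thesis
      by (simp add: free_expr_ty_def heap_expr_def heap_args_def dl hl)
  qed
  then have "map (map_prod \<sigma> (map_expr \<sigma> id)) (free_ctx X ?d (h i)) =
      map (\<lambda>j. (j, heap_expr \<phi> h j)) (map ?f [1..<?d])"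
    using \<sigma>f by (auto simp: free_ctx_def)
  also have "\<dots> = ancestors_ctx \<phi> h i 1"
    unfolding ancestors_ctx_def ancestors_list[OF \<phi> i] ..
  finally show ?thesis
    using \<sigma> by (intro exI[of _ \<sigma>] conjI)
qed

text \<open>The missing nodes are inserted in increasing order. When \<open>m\<close> is inserted, the part of the context
  before it is \<open>heap_ctx m \<phi> h\<close>, over which the type of \<open>m\<close> is derivable. The node \<open>m\<close> is fresh: the types
  before it mention smaller nodes only, and the types after it belong to ancestors of \<open>i\<close> and mention
  ancestors of \<open>i\<close>, to which \<open>m\<close> does not belong.\<close>

lemma derived_weaken_ancestors:
  fixes T :: "(nat \<times> 'a, nat \<times> 'b) gat"
  assumes \<phi>: "\<phi> \<in> Hp n" and i: "i \<in> {1..n}"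
    and smaller: "\<And>j. 1 \<le> j \<Longrightarrow> j < i \<Longrightarrow> (heap_ctx j \<phi> h, IsTy (heap_expr \<phi> h j)) \<in> derived T"
    and R: "(ancestors_ctx \<phi> h i 1, R) \<in> derived T"
  shows "(heap_ctx i \<phi> h, R) \<in> derived T"
proof -
  let ?anc = "\<lambda>j. \<exists>k\<ge>1. j = (\<phi> ^^ k) i"
  let ?c = "map (\<lambda>j. (j, heap_expr \<phi> h j :: (nat \<times> 'a, nat \<times> 'b) exp))"
  have "m \<le> i \<Longrightarrow> (ancestors_ctx \<phi> h i m, R) \<in> derived T" if "m \<ge> 1" for m
    using that
  proof (induction m rule: nat_induct_at_least)
    case base
    then show ?case using R by simp
  next
    case (Suc m)
    then have m: "1 \<le> m" "m < i" and IH: "(ancestors_ctx \<phi> h i m, R) \<in> derived T" by simp_all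
    show ?case
    proof (cases "?anc m")
      case True
      then have "(j < Suc m \<or> ?anc j) \<longleftrightarrow> (j < m \<or> ?anc j)" for j by (auto simp: less_Suc_eq)
      then show ?thesis using IH by (simp only: ancestors_ctx_def)
    next
      case False
      let ?\<Delta> = "?c (filter ?anc [Suc m..<i])"
      have split: "[1..<i] = [1..<m] @ m # [Suc m..<i]"
        using upt_add_eq_append[of 1 m "i - m"] m by (simp add: upt_conv_Cons)
      have low: "filter (\<lambda>j. j < m' \<or> ?anc j) [1..<m] = [1..<m]" if "m \<le> m'" for m'
        using that by (intro filter_True) auto
      have high: "filter (\<lambda>j. j < m' \<or> ?anc j) [Suc m..<i] = filter ?anc [Suc m..<i]" if "m' \<le> Suc m" for m'
        using that by (intro filter_cong) auto
      have eq: "ancestors_ctx \<phi> h i m = heap_ctx m \<phi> h @ ?\<Delta>"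
        "ancestors_ctx \<phi> h i (Suc m) = heap_ctx m \<phi> h @ (m, heap_expr \<phi> h m) # ?\<Delta>"
        using False low[of m] low[of "Suc m"] high[of m] high[of "Suc m"]
        unfolding ancestors_ctx_def split heap_ctx_def by simp_all
      have "m \<notin> ctx_fv (heap_ctx m \<phi> h :: (nat \<times> 'a, nat \<times> 'b) ctx)"
      proof
        assume "m \<in> ctx_fv (heap_ctx m \<phi> h :: (nat \<times> 'a, nat \<times> 'b) ctx)"
        then obtain j where j: "j \<in> {1..<m}" "m \<in> insert j (fv (heap_expr \<phi> h j :: (nat \<times> 'a, nat \<times> 'b) exp))"
          by (auto simp: ctx_fv_def heap_ctx_def)
        then obtain l where "m = (\<phi> ^^ (dp \<phi> j - l)) j" by (auto simp: fv_heap_expr)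
        also have "\<dots> \<le> j - (dp \<phi> j - l)" using j m i by (intro Hp_funpow_le[OF \<phi>]) simp
        finally show False using j(1) by auto
      qed
      moreover have "m \<notin> ctx_fv ?\<Delta>"
      proof
        assume "m \<in> ctx_fv ?\<Delta>"
        then obtain j k where j: "Suc m \<le> j" "k \<ge> 1" "j = (\<phi> ^^ k) i"
            "m \<in> insert j (fv (heap_expr \<phi> h j :: (nat \<times> 'a, nat \<times> 'b) exp))"
          by (auto simp: ctx_fv_def)
        then obtain l where "m = (\<phi> ^^ (dp \<phi> j - l)) ((\<phi> ^^ k) i)" by (auto simp: fv_heap_expr)
        then have "m = (\<phi> ^^ (dp \<phi> j - l + k)) i" by (simp add: funpow_add)
        moreover have "dp \<phi> j - l + k \<ge> 1" using j by simp
        ultimately show False using False by blast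
      qed
      ultimately show ?thesis
        unfolding eq(2) using IH smaller[OF m] by (intro derived_weak) (simp_all add: eq(1))
    qed
  qed
  from this[of i] have "(ancestors_ctx \<phi> h i i, R) \<in> derived T" using i by simp
  moreover have "ancestors_ctx \<phi> h i i = (heap_ctx i \<phi> h :: (nat \<times> 'a, nat \<times> 'b) ctx)"
    unfolding ancestors_ctx_def heap_ctx_def by (subst filter_True) auto
  ultimately show ?thesis by simp
qed

lemma derived_heap_ty:
  fixes X :: "('a, 'b) presheaf"
  assumes X: "is_presheaf X" and \<phi>: "\<phi> \<in> Hp n" and h: "h \<in> heap_maps X n \<phi>"
  shows "i \<in> {1..n} \<Longrightarrow> (heap_ctx i \<phi> h, IsTy (heap_expr \<phi> h i)) \<in> derived (G_obj X)"
proof (induction i rule: less_induct)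
  case (less i)
  let ?d = "dp \<phi> i"
  obtain \<sigma> where \<sigma>: "bij \<sigma>" "map \<sigma> [1..<?d] = map (\<lambda>l. (\<phi> ^^ (?d - l)) i) [1..<?d]"
    "map (map_prod \<sigma> (map_expr \<sigma> id)) (free_ctx X ?d (h i)) = ancestors_ctx \<phi> h i 1"
    using ex_permute_free_ctx[OF \<phi> h less.prems] by (elim exE conjE)
  have "h i \<in> Ty X ?d" using h less.prems unfolding heap_maps_iff[OF \<phi>] by simp
  then have "permute \<sigma> (free_ty X ?d (h i)) \<in> derived (G_obj X)"
    using derived_free_ty[OF X dp_pos[OF \<phi> less.prems]] \<sigma>(1) by (intro derived_permute) simp_all
  moreover have "map_expr \<sigma> id (free_expr_ty ?d (h i)) =
      (heap_expr \<phi> h i :: (nat \<times> 'a, nat \<times> 'b) exp)"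
    by (simp add: free_expr_ty_def heap_expr_def comp_def heap_args_eqI[OF \<sigma>(2)])
  ultimately have "(ancestors_ctx \<phi> h i 1, IsTy (heap_expr \<phi> h i)) \<in> derived (G_obj X)"
    using \<sigma>(3) by (simp add: free_ty_def)
  then show ?case
    using less by (intro derived_weaken_ancestors[OF \<phi> less.prems]) simp_all
qed

lemma derived_heap_tm:
  fixes X :: "('a, 'b) presheaf"
  assumes X: "is_presheaf X" and \<phi>: "\<phi> \<in> Hp n" and h: "h \<in> heap_maps X n \<phi>" and i: "i \<in> {1..n}"
    and a: "a \<in> tm_fibre X (dp \<phi> i) (h i)"
  shows "(heap_ctx i \<phi> h, HasTm (App (Inr (dp \<phi> i, a)) (heap_args \<phi> i)) (heap_expr \<phi> h i))
    \<in> derived (G_obj X)"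
proof -
  let ?d = "dp \<phi> i"
  obtain \<sigma> where \<sigma>: "bij \<sigma>" "map \<sigma> [1..<?d] = map (\<lambda>l. (\<phi> ^^ (?d - l)) i) [1..<?d]"
    "map (map_prod \<sigma> (map_expr \<sigma> id)) (free_ctx X ?d (h i)) = ancestors_ctx \<phi> h i 1"
    using ex_permute_free_ctx[OF \<phi> h i] by (elim exE conjE)
  have a': "a \<in> Tm X ?d" "bdTm X ?d a = h i" using a by (simp_all add: tm_fibre_def)
  then have "permute \<sigma> (free_tm X ?d a) \<in> derived (G_obj X)"
    using derived_free_tm[OF X dp_pos[OF \<phi> i]] \<sigma>(1) by (intro derived_permute) simp_all
  moreover have "map_expr \<sigma> id (free_expr_ty ?d (h i)) =
      (heap_expr \<phi> h i :: (nat \<times> 'a, nat \<times> 'b) exp)"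
    by (simp add: free_expr_ty_def heap_expr_def comp_def heap_args_eqI[OF \<sigma>(2)])
  ultimately have "(ancestors_ctx \<phi> h i 1, HasTm (App (Inr (?d, a)) (heap_args \<phi> i)) (heap_expr \<phi> h i))
      \<in> derived (G_obj X)"
    using \<sigma>(3) a'(2) by (simp add: free_tm_def comp_def heap_args_eqI[OF \<sigma>(2)])
  then show ?thesis
    using i by (intro derived_weaken_ancestors[OF \<phi> i] derived_heap_ty[OF X \<phi> h]) simp_all
qed

lemma heap_expr_restrict:
  assumes \<phi>: "\<phi> \<in> Hp n" and i: "i \<in> {1..m}" "m \<le> n"
  shows "heap_expr (restrict \<phi> {0..m}) (restrict h {1..m}) i = heap_expr \<phi> h i"
  using i dp_restrict[OF \<phi> i(2), of i] funpow_restrict[OF \<phi> i(2), of i]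
  by (simp add: heap_expr_def heap_args_def)

lemma heap_ctx_restrict:
  assumes \<phi>: "\<phi> \<in> Hp n" and "m \<le> n"
  shows "heap_ctx m (restrict \<phi> {0..m}) (restrict h {1..m}) = heap_ctx m \<phi> h"
  using assms(2) by (auto simp: heap_ctx_def heap_expr_restrict[OF \<phi>, unfolded One_nat_def])

lemma heap_ctx_Suc:
  "m \<ge> 1 \<Longrightarrow> heap_ctx (Suc m) \<phi> h = heap_ctx m \<phi> h @ [(m, heap_expr \<phi> h m)]"
  by (simp add: heap_ctx_def)

lemma degree_heap_ctx: "n \<ge> 1 \<Longrightarrow> degree (heap_ctx n \<phi> h, R) = n"
  by (simp add: degree_def heap_ctx_def)

section \<open>The multiplication on heaps\<close>

lemma WH_Ty_iff: "(\<phi>, h) \<in> Ty (WH X) n \<longleftrightarrow> \<phi> \<in> Hp n \<and> h \<in> heap_maps X n \<phi>"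
  by (simp add: WH_def)

context
  fixes X :: "('a, 'b) presheaf" and n :: nat and \<psi> :: "nat \<Rightarrow> nat"
    and H :: "nat \<Rightarrow> (nat \<Rightarrow> nat) \<times> (nat \<Rightarrow> 'a)"
  assumes X: "is_presheaf X" and \<psi>H: "(\<psi>, H) \<in> Ty (WH (WH X)) n"
begin

lemma outer_heap: "\<psi> \<in> Hp n"
  using \<psi>H by (simp add: WH_Ty_iff)

lemma inner_heap:
  assumes "i \<in> {1..n}"
  shows "fst (H i) \<in> Hp (dp \<psi> i)" "snd (H i) \<in> heap_maps X (dp \<psi> i) (fst (H i))"
  using \<psi>H assms unfolding WH_Ty_iff heap_maps_iff[OF outer_heap]
  by (cases "H i"; simp add: WH_Ty_iff; metis WH_Ty_iff atLeastAtMost_iff)+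

lemma inner_parent:
  assumes i: "i \<in> {1..n}" and j: "\<psi> i \<noteq> 0"
  shows "H (\<psi> i) = (restrict (fst (H i)) {0..dp \<psi> (\<psi> i)}, restrict (snd (H i)) {1..dp \<psi> (\<psi> i)})"
proof -
  have "H (\<psi> i) = bdTy (WH X) (dp \<psi> (\<psi> i)) (H i)"
    using \<psi>H i j unfolding WH_Ty_iff heap_maps_iff[OF outer_heap] by blast
  then show ?thesis by (simp add: WH_def split_beta)
qed

text \<open>The boundary in the heap description is restriction, so naturality of \<open>(\<phi>, h)\<close> makes the element at
  the ancestor of depth \<open>m\<close> the restriction to \<open>[m]\<close> of the element at \<open>i\<close>.\<close>

lemma inner_ancestor:
  assumes i: "i \<in> {1..n}" and m: "m \<in> {1..dp \<psi> i}"
  defines "j \<equiv> (\<psi> ^^ (dp \<psi> i - m)) i"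
  shows "j \<in> {1..n}" "dp \<psi> j = m" "fst (H j) = restrict (fst (H i)) {0..m}"
    "snd (H j) = restrict (snd (H i)) {1..m}"
proof -
  note \<psi> = outer_heap
  have "fst (H ((\<psi> ^^ k) i)) = restrict (fst (H i)) {0..dp \<psi> i - k} \<and>
      snd (H ((\<psi> ^^ k) i)) = restrict (snd (H i)) {1..dp \<psi> i - k}" if "k < dp \<psi> i" for k
    using that
  proof (induction k)
    case 0
    have "fst (H i) \<in> extensional {0..dp \<psi> i}" "snd (H i) \<in> extensional {1..dp \<psi> i}"
      using inner_heap[OF i] by (simp_all add: Hp_def heap_maps_def PiE_def)
    then show ?case by (simp add: extensional_restrict)
  next
    case (Suc k)
    let ?v = "(\<psi> ^^ k) i"
    have v: "?v \<in> {1..n}" using dp_funpow[OF \<psi> i, of k] Suc.prems by simp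
    have Sv: "\<psi> ?v \<noteq> 0" "dp \<psi> (\<psi> ?v) = dp \<psi> i - Suc k"
      using dp_funpow[OF \<psi> i Suc.prems] by simp_all
    have "H (\<psi> ?v) = (restrict (fst (H ?v)) {0..dp \<psi> i - Suc k}, restrict (snd (H ?v)) {1..dp \<psi> i - Suc k})"
      using inner_parent[OF v Sv(1)] Sv(2) by simp
    moreover have "{0..dp \<psi> i - k} \<inter> {0..dp \<psi> i - Suc k} = {0..dp \<psi> i - Suc k}"
      "{1..dp \<psi> i - k} \<inter> {1..dp \<psi> i - Suc k} = {1..dp \<psi> i - Suc k}" by auto
    ultimately show ?case using Suc by (simp add: restrict_restrict del: restrict_apply)
  qed
  from this[of "dp \<psi> i - m"] show "fst (H j) = restrict (fst (H i)) {0..m}"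
    "snd (H j) = restrict (snd (H i)) {1..m}"
    using m by (simp_all add: j_def)
  show "j \<in> {1..n}" "dp \<psi> j = m"
    using dp_funpow[OF \<psi> i, of "dp \<psi> i - m"] m by (simp_all add: j_def)
qed

lemma star_heap_Hp: "star_heap n \<psi> H \<in> Hp n"
proof -
  have less: "star_heap n \<psi> H i < i" if i: "i \<in> {1..n}" for i
  proof -
    have "dp \<psi> i \<in> {1..dp \<psi> i}" using dp_pos[OF outer_heap i] by simp
    then have "fst (H i) (dp \<psi> i) < dp \<psi> i" by (rule Hp_less[OF inner_heap(1)[OF i]])
    then have "i - (dp \<psi> i - fst (H i) (dp \<psi> i)) < i" using i by (intro diff_less) auto
    moreover have "star_heap n \<psi> H i \<le> i - (dp \<psi> i - fst (H i) (dp \<psi> i))"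
      using i Hp_funpow_le[OF outer_heap, of i] by (simp add: star_heap_def)
    ultimately show ?thesis by simp
  qed
  moreover have "star_heap n \<psi> H i \<le> n" if "i \<le> n" for i
    using less[of i] that by (cases "i = 0") (auto simp: star_heap_def)
  ultimately show ?thesis
    by (auto simp: Hp_def star_heap_def)
qed

text \<open>By induction on \<open>k\<close>: if \<open>m = \<phi>\<^sub>i\<^sup>k(#i)\<close> is positive, the left-hand side has reached the ancestor \<open>j\<close> of
  \<open>i\<close> of depth \<open>m\<close>, and the next step there is governed by \<open>\<phi>\<^sub>j\<close>, which is a restriction of \<open>\<phi>\<^sub>i\<close>.\<close>

lemma funpow_star_heap:
  assumes i: "i \<in> {1..n}"
  shows "(star_heap n \<psi> H ^^ k) i = (\<psi> ^^ (dp \<psi> i - (fst (H i) ^^ k) (dp \<psi> i))) i"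
proof (induction k)
  case (Suc k)
  let ?d = "dp \<psi> i" and ?\<phi> = "fst (H i)"
  define m where "m = (?\<phi> ^^ k) ?d"
  have \<phi>: "?\<phi> \<in> Hp ?d" by (rule inner_heap(1)[OF i])
  have m_le: "m \<le> ?d" using Hp_funpow_le[OF \<phi>, of ?d k] by (simp add: m_def)
  have "star_heap n \<psi> H ((\<psi> ^^ (?d - m)) i) = (\<psi> ^^ (?d - ?\<phi> m)) i"
  proof (cases "m = 0")
    case True
    then show ?thesis using Hp_0[OF \<phi>] funpow_dp[OF outer_heap i, of ?d] by (simp add: star_heap_def)
  next
    case False
    then have m: "m \<in> {1..?d}" using m_le by simp
    note j = inner_ancestor[OF i m]
    have \<phi>m: "?\<phi> m < m" by (rule Hp_less[OF \<phi> m])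
    have "(m - ?\<phi> m) + (?d - m) = ?d - ?\<phi> m" using \<phi>m m_le by simp
    then have "(\<psi> ^^ (m - ?\<phi> m)) ((\<psi> ^^ (?d - m)) i) = (\<psi> ^^ (?d - ?\<phi> m)) i"
      by (metis funpow_add o_apply)
    then show ?thesis using j by (simp add: star_heap_def)
  qed
  then show ?case using Suc by (simp add: m_def)
qed simp

text \<open>The iterates of \<open>\<psi> \<star> \<phi>\<close> at \<open>i\<close> vanish exactly when those of \<open>\<phi>\<^sub>i\<close> at \<open>#i\<close> do.\<close>

lemma dp_star_heap:
  assumes i: "i \<in> {1..n}"
  shows "dp (star_heap n \<psi> H) i = dp (fst (H i)) (dp \<psi> i)"
proof (rule dp_eqI[OF star_heap_Hp i])
  let ?d = "dp \<psi> i" and ?\<phi> = "fst (H i)"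
  have \<phi>: "?\<phi> \<in> Hp ?d" by (rule inner_heap(1)[OF i])
  have d: "?d \<in> {1..?d}" using dp_pos[OF outer_heap i] by simp
  show "(star_heap n \<psi> H ^^ dp ?\<phi> ?d) i = 0"
    using funpow_dp[OF \<phi> d, of "dp ?\<phi> ?d"] funpow_dp[OF outer_heap i, of ?d]
    by (simp add: funpow_star_heap[OF i])
  show "(star_heap n \<psi> H ^^ k) i \<noteq> 0" if k: "k < dp ?\<phi> ?d" for k
  proof -
    have "(?\<phi> ^^ k) ?d \<in> {1..?d}" using dp_funpow[OF \<phi> d k] by simp
    then have "(\<psi> ^^ (?d - (?\<phi> ^^ k) ?d)) i \<in> {1..n}" by (rule inner_ancestor(1)[OF i])
    then show ?thesis by (simp add: funpow_star_heap[OF i])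
  qed
qed

lemma star_mem_WH: "(star_heap n \<psi> H, star_map n \<psi> H) \<in> Ty (WH X) n"
proof -
  let ?\<chi> = "star_heap n \<psi> H"
  have "star_map n \<psi> H i \<in> Ty X (dp ?\<chi> i) \<and>
      (?\<chi> i \<noteq> 0 \<longrightarrow> star_map n \<psi> H (?\<chi> i) = bdTy X (dp ?\<chi> (?\<chi> i)) (star_map n \<psi> H i))"
    if i: "i \<in> {1..n}" for i
  proof -
    let ?d = "dp \<psi> i" and ?\<phi> = "fst (H i)" and ?h = "snd (H i)"
    let ?m = "?\<phi> ?d"
    note \<phi> = inner_heap(1)[OF i]
    have d: "?d \<in> {1..?d}" using dp_pos[OF outer_heap i] by simp
    have h: "?h ?d \<in> Ty X (dp ?\<phi> ?d)" "?m \<noteq> 0 \<Longrightarrow> ?h ?m = bdTy X (dp ?\<phi> ?m) (?h ?d)"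
      using inner_heap(2)[OF i] d unfolding heap_maps_iff[OF \<phi>] by blast+
    have si: "star_map n \<psi> H i = ?h ?d" using i by (simp add: star_map_def)
    have "star_map n \<psi> H (?\<chi> i) = bdTy X (dp ?\<chi> (?\<chi> i)) (star_map n \<psi> H i)" if nz: "?\<chi> i \<noteq> 0"
    proof -
      have \<chi>i: "?\<chi> i = (\<psi> ^^ (?d - ?m)) i" using i by (simp add: star_heap_def)
      have "?m \<noteq> 0" using nz funpow_dp[OF outer_heap i, of ?d] unfolding \<chi>i by (intro notI) simp
      then have m: "?m \<in> {1..?d}" using Hp_less[OF \<phi> d] by simp
      note j = inner_ancestor[OF i m, folded \<chi>i]
      have "dp ?\<chi> (?\<chi> i) = dp ?\<phi> ?m"
        using dp_star_heap[OF j(1)] j(2,3) m dp_restrict[OF \<phi>, of ?m ?m] by simp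
      moreover have "star_map n \<psi> H (?\<chi> i) = ?h ?m" using j m by (simp add: star_map_def)
      ultimately show ?thesis using h(2) m si by simp
    qed
    then show ?thesis using h(1) si dp_star_heap[OF i] by simp
  qed
  then have "star_map n \<psi> H \<in> heap_maps X n ?\<chi>"
    unfolding heap_maps_iff[OF star_heap_Hp] by (simp add: star_map_def)
  then show ?thesis using star_heap_Hp by (simp add: WH_Ty_iff)
qed

lemma ident_ty_mem_W:
  assumes i: "i \<in> {1..n}"
  shows "ident_ty X (dp \<psi> i) (H i) \<in> Ty (W_obj X) (dp \<psi> i)"
proof -
  obtain \<phi> h where Hi: "H i = (\<phi>, h)" by (cases "H i")
  have d: "dp \<psi> i \<in> {1..dp \<psi> i}" using dp_pos[OF outer_heap i] by simp
  show ?thesis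
    using derived_heap_ty[OF X inner_heap[OF i] d] degree_heap_ctx d
    by (auto simp: ident_ty_def Hi intro!: W_ty_I)
qed

text \<open>Naturality of the identification \<open>WH X \<cong> W X\<close>: the context of the judgement of a heap ends with the
  judgement of the restricted heap.\<close>

lemma ident_ty_heap_maps:
  "(\<lambda>i\<in>{1..n}. ident_ty X (dp \<psi> i) (H i)) \<in> heap_maps (W_obj X) n \<psi>"
proof -
  have "ident_ty X (dp \<psi> (\<psi> i)) (H (\<psi> i)) = bdTy (W_obj X) (dp \<psi> (\<psi> i)) (ident_ty X (dp \<psi> i) (H i))"
    if i: "i \<in> {1..n}" and nz: "\<psi> i \<noteq> 0" for i
  proof -
    obtain \<phi> h where Hi: "H i = (\<phi>, h)" by (cases "H i")
    let ?m = "dp \<psi> (\<psi> i)"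
    have j: "\<psi> i \<in> {1..n}" using Hp_less[OF outer_heap i] i nz by simp
    have m: "?m \<ge> 1" by (rule dp_pos[OF outer_heap j])
    have d: "dp \<psi> i = Suc ?m" using dp_rec[OF outer_heap i] nz by simp
    have \<phi>: "\<phi> \<in> Hp (Suc ?m)" "h \<in> heap_maps X (Suc ?m) \<phi>" using inner_heap[OF i] Hi d by simp_all
    have der: "(heap_ctx (Suc ?m) \<phi> h, IsTy (heap_expr \<phi> h (Suc ?m))) \<in> derived (G_obj X)"
      using derived_heap_ty[OF X \<phi>, of "Suc ?m"] by simp
    have "H (\<psi> i) = (restrict \<phi> {0..?m}, restrict h {1..?m})"
      using inner_parent[OF i nz] Hi by simp
    then show ?thesis
      using bdTy_W[OF X der[unfolded heap_ctx_Suc[OF m]], of ?m] m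
      by (simp add: ident_ty_def Hi d heap_ctx_Suc[OF m] heap_ctx_restrict[OF \<phi>(1), unfolded One_nat_def]
          heap_expr_restrict[OF \<phi>(1), unfolded One_nat_def])
  qed
  moreover have "\<psi> i \<in> {1..n}" if "i \<in> {1..n}" "\<psi> i \<noteq> 0" for i
    using Hp_less[OF outer_heap that(1)] that by simp
  ultimately show ?thesis
    unfolding heap_maps_iff[OF outer_heap] using ident_ty_mem_W by simp
qed

lemma inner_args_star:
  assumes i: "i \<in> {1..n}"
  shows "map (map_expr (\<lambda>m. (\<psi> ^^ (dp \<psi> i - m)) i) id) (heap_args (fst (H i)) (dp \<psi> i)) =
    heap_args (star_heap n \<psi> H) i"
  by (simp add: heap_args_def dp_star_heap[OF i] funpow_star_heap[OF i])

text \<open>The class at \<open>i\<close> is represented by a judgement with variables \<open>1, \<dots>, #i - 1\<close>, and the constant is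
  applied to the ancestors of \<open>i\<close> in the outer heap; so the variable \<open>m\<close> becomes the ancestor of
  depth \<open>m\<close>.\<close>

lemma inst_heap_expr:
  assumes i: "i \<in> {1..n}"
  shows "inst (heap_expr \<psi> (\<lambda>i\<in>{1..n}. ident_ty X (dp \<psi> i) (H i)) i) =
    heap_expr (star_heap n \<psi> H) (star_map n \<psi> H) i"
proof -
  obtain \<phi> h where Hi: "H i = (\<phi>, h)" by (cases "H i")
  let ?d = "dp \<psi> i"
  let ?\<rho> = "\<lambda>m. (\<psi> ^^ (?d - m)) i"
  have d: "?d \<in> {1..?d}" using dp_pos[OF outer_heap i] by simp
  have \<phi>: "\<phi> \<in> Hp ?d" "h \<in> heap_maps X ?d \<phi>" using inner_heap[OF i] Hi by simp_all
  have "inst (App (Inl (?d, ident_ty X ?d (H i))) (map Var (map ?\<rho> [1..<?d]))) =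
      map_expr ?\<rho> id (subject (IsTy (heap_expr \<phi> h ?d)))"
    by (rule inst_App[OF X derived_heap_ty[OF X \<phi> d]]) (simp_all add: constant_class_def ident_ty_def Hi)
  also have "\<dots> = heap_expr (star_heap n \<psi> H) (star_map n \<psi> H) i"
    using inner_args_star[OF i] i dp_star_heap[OF i] by (simp add: heap_expr_def Hi star_map_def)
  finally show ?thesis using i by (simp add: heap_expr_def heap_args_Var del: inst.simps)
qed

lemma inst_heap_ctx:
  "map (map_prod id inst) (heap_ctx n \<psi> (\<lambda>i\<in>{1..n}. ident_ty X (dp \<psi> i) (H i))) =
    heap_ctx n (star_heap n \<psi> H) (star_map n \<psi> H)"
  using inst_heap_expr by (auto simp: heap_ctx_def)

lemma W_mult_ty:
  assumes n: "n \<ge> 1"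
  shows "W_mult X (ident2_ty X n (\<psi>, H)) = ident_ty X n (star_heap n \<psi> H, star_map n \<psi> H)"
proof -
  let ?h = "\<lambda>i\<in>{1..n}. ident_ty X (dp \<psi> i) (H i)"
  have "(heap_ctx n \<psi> ?h, IsTy (heap_expr \<psi> ?h n)) \<in> derived (G_obj (W_obj X))"
    using n by (intro derived_heap_ty[OF is_presheaf_W[OF X] outer_heap ident_ty_heap_maps]) simp
  from W_mult_class[OF X this] show ?thesis
    using inst_heap_ctx inst_heap_expr[of n] n
    by (simp add: ident2_ty_def relabel_def ident_ty_def[of "W_obj X"] ident_ty_def[of X n])
qed

text \<open>In the context and the type the substitution acts as in \<open>W_mult_ty\<close>; the term is handled like
  \<open>inst_heap_expr\<close>, with a class of term judgements at the last node.\<close>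

lemma W_mult_tm:
  assumes n: "n \<ge> 1" and p: "H n = p" and a: "a \<in> tm_fibre X (dp (fst p) (dp \<psi> n)) (snd p (dp \<psi> n))"
  shows "W_mult X (ident2_tm X n ((\<psi>, H), (p, a))) =
    ident_tm X n ((star_heap n \<psi> H, star_map n \<psi> H), a)"
proof -
  let ?h = "\<lambda>i\<in>{1..n}. ident_ty X (dp \<psi> i) (H i)"
  let ?d = "dp \<psi> n"
  let ?\<rho> = "\<lambda>m. (\<psi> ^^ (?d - m)) n"
  obtain \<phi> h where p': "p = (\<phi>, h)" by (cases p)
  have nn: "n \<in> {1..n}" using n by simp
  have d: "?d \<in> {1..?d}" using dp_pos[OF outer_heap nn] by simp
  have \<phi>: "\<phi> \<in> Hp ?d" "h \<in> heap_maps X ?d \<phi>" using inner_heap[OF nn] p p' by simp_all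
  let ?t = "App (Inr (dp \<phi> ?d, a)) (heap_args \<phi> ?d)"
  let ?c = "ident_tm X ?d (p, a)"
  have der: "(heap_ctx ?d \<phi> h, HasTm ?t (heap_expr \<phi> h ?d)) \<in> derived (G_obj X)"
    using a p' by (intro derived_heap_tm[OF X \<phi> d]) simp
  have c: "?c = equiv_judgements (G_obj X) `` {(heap_ctx ?d \<phi> h, HasTm ?t (heap_expr \<phi> h ?d))}"
    by (simp add: ident_tm_def p')
  have "?c \<in> Tm (W_obj X) ?d"
    unfolding c using der d by (intro W_tm_I) (simp_all add: degree_heap_ctx)
  moreover have "bdTm (W_obj X) ?d ?c = ?h n"
    unfolding c bdTm_W[OF X der] using n p p' by (simp add: ident_ty_def)
  ultimately have fibre: "?c \<in> tm_fibre (W_obj X) ?d (?h n)" by (simp add: tm_fibre_def)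
  have der2: "(heap_ctx n \<psi> ?h, HasTm (App (Inr (?d, ?c)) (heap_args \<psi> n)) (heap_expr \<psi> ?h n))
      \<in> derived (G_obj (W_obj X))"
    by (rule derived_heap_tm[OF is_presheaf_W[OF X] outer_heap ident_ty_heap_maps nn fibre])
  have "inst (App (Inr (?d, ?c)) (map Var (map ?\<rho> [1..<?d]))) =
      map_expr ?\<rho> id (subject (HasTm ?t (heap_expr \<phi> h ?d)))"
    by (rule inst_App[OF X der]) (simp_all add: constant_class_def c)
  also have "\<dots> = App (Inr (dp (star_heap n \<psi> H) n, a)) (heap_args (star_heap n \<psi> H) n)"
    using inner_args_star[OF nn] dp_star_heap[OF nn] by (simp add: p p')
  finally have "inst (App (Inr (?d, ?c)) (heap_args \<psi> n)) =
      App (Inr (dp (star_heap n \<psi> H) n, a)) (heap_args (star_heap n \<psi> H) n)"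
    by (simp only: heap_args_Var)
  then show ?thesis
    using W_mult_class[OF X der2] inst_heap_ctx inst_heap_expr[OF nn]
    by (simp add: ident2_tm_def relabel_def ident_tm_def[of "W_obj X"] ident_tm_def[of X n] del: inst.simps)
qed

end

theorem proposition23:
  fixes X :: "('a, 'b) presheaf" and n :: nat
  assumes "is_presheaf X" and "n \<ge> 1"
  shows
    "(\<forall>\<psi> H. (\<psi>, H) \<in> Ty (WH (WH X)) n \<longrightarrow>
        (star_heap n \<psi> H, star_map n \<psi> H) \<in> Ty (WH X) n \<and>
        W_mult X (ident2_ty X n (\<psi>, H)) =
          ident_ty X n (star_heap n \<psi> H, star_map n \<psi> H)) \<and>
     (\<forall>\<psi> H p a. ((\<psi>, H), (p, a)) \<in> Tm (WH (WH X)) n \<longrightarrow>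
        ((star_heap n \<psi> H, star_map n \<psi> H), a) \<in> Tm (WH X) n \<and>
        W_mult X (ident2_tm X n ((\<psi>, H), (p, a))) =
          ident_tm X n ((star_heap n \<psi> H, star_map n \<psi> H), a))"
proof (intro conjI allI impI)
  fix \<psi> H assume "(\<psi>, H) \<in> Ty (WH (WH X)) n"
  then show "(star_heap n \<psi> H, star_map n \<psi> H) \<in> Ty (WH X) n"
    "W_mult X (ident2_ty X n (\<psi>, H)) = ident_ty X n (star_heap n \<psi> H, star_map n \<psi> H)"
    by (rule star_mem_WH[OF assms(1)] W_mult_ty[OF assms(1) _ assms(2)])+
next
  fix \<psi> H p a assume t: "((\<psi>, H), (p, a)) \<in> Tm (WH (WH X)) n"
  have n: "n \<in> {1..n}" using assms(2) by simp
  have \<psi>H: "(\<psi>, H) \<in> Ty (WH (WH X)) n" and pa: "(p, a) \<in> Tm (WH X) (dp \<psi> n)" "H n = p"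
    using t by (simp_all add: WH_def[of "WH X"] tm_fibre_def) (simp add: WH_def)
  have a: "a \<in> tm_fibre X (dp (fst p) (dp \<psi> n)) (snd p (dp \<psi> n))"
    using pa(1) by (cases p) (simp add: WH_def)
  show "W_mult X (ident2_tm X n ((\<psi>, H), (p, a))) =
      ident_tm X n ((star_heap n \<psi> H, star_map n \<psi> H), a)"
    by (rule W_mult_tm[OF assms(1) \<psi>H assms(2) pa(2) a])
  show "((star_heap n \<psi> H, star_map n \<psi> H), a) \<in> Tm (WH X) n"
    using star_mem_WH[OF assms(1) \<psi>H] a pa(2) n dp_star_heap[OF assms(1) \<psi>H n]
    by (simp add: WH_def star_map_def)
qed

end
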